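(* Let $\mathbb{X},\mathbb{A},A(\cdot),c,q$ be as in the context. Suppose that: (T) there exist a continuous function $V:\mathbb{X}\to[1,\infty)$ and a constant $K$ such that $\sum_{n=0}^\infty Q_\phi^nV(x)\le KV(x)<\infty$ for all $\phi\in\mathbb{F}$ and $x\in\mathbb{X}$; (W-i) the set-valued mapping $x\mapsto A(x)$ is compact-valued and continuous on $\mathbb{X}$; (W-ii) the transition kernel $q$ is weakly continuous; (W-iii) $(x,a)\mapsto c(x,a)$ is lower semicontinuous on $\mathrm{Gr}(A)$; and that the function $(x,a)\mapsto\int_{\mathbb{X}}V(y)\,q(dy|x,a)$ is continuous on $\mathrm{Gr}(A)$. Then: (i) the value function $v$ satisfies, for all $x\in\mathbb{X}$, $$v(x)=\min_{a\in A(x)}\Big[c(x,a)+\int_{\mathbb{X}}v(y)\,q(dy|x,a)\Big];$$ (ii) there exists a stationary policy that is total-cost optimal; (iii) a stationary policy $\phi$ is total-cost optimal if and only if $$v(x)=c(x,\phi(x))+\int_{\mathbb{X}}v(y)\,q(dy|x,\phi(x))\qquad\text{for all }x\in\mathbb{X},$$ which holds if and only if $\phi$ is $\tilde\beta$-optimal for the MDP defined by the HV transformation described in the context.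
   Context: Setting. $\mathbb{X}$ and $\mathbb{A}$ are Borel subsets of complete separable metric spaces, with Borel $\sigma$-algebras. For each $x\in\mathbb{X}$, $A(x)$ is a nonempty Borel subset of $\mathbb{A}$. $\mathrm{Gr}(A):=\{(x,a):x\in\mathbb{X},a\in A(x)\}$ is Borel in $\mathbb{X}\times\mathbb{A}$ and contains the graph of a Borel function $\mathbb{X}\to\mathbb{A}$. The one-step cost $c:\mathrm{Gr}(A)\to[0,\infty)$ is Borel. For each $(x,a)\in\mathrm{Gr}(A)$, $q(\cdot|x,a)$ is a finite measure on $(\mathbb{X},\mathcal{B}(\mathbb{X}))$, $q(B|\cdot)$ is Borel on $\mathrm{Gr}(A)$ for each $B\in\mathcal{B}(\mathbb{X})$, and $\sup_{\mathrm{Gr}(A)}q(\mathbb{X}|x,a)<\infty$ (the mass need not be one). $\mathbb{F}$ is the set of Borel $\phi:\mathbb{X}\to\mathbb{A}$ with $\phi(x)\in A(x)$ for all $x$ (stationary policies). For $\phi\in\mathbb{F}$: $Q_\phi u(x):=\int_{\mathbb{X}}u(y)\,q(dy|x,\phi(x))$, $Q_\phi^0u:=u$, $Q_\phi^nu:=Q_\phi(Q_\phi^{n-1}u)$. Policies and total cost. A policy $\pi$ is a sequence of Borel-measurable, history-dependent, possibly randomized decision rules $\pi_n(\cdot|x_0a_0\cdots x_n)$, probability measures on $\mathbb{A}$ with $\pi_n(A(x_n)|x_0a_0\cdots x_n)=1$; $\Pi$ is the set of all policies. Put $\alpha(x,a):=q(\mathbb{X}|x,a)$ and $p(\cdot|x,a):=q(\cdot|x,a)/\alpha(x,a)$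 (if $\alpha(x,a)=0$, let $p(\cdot|x,a)$ be any fixed probability measure on $\mathbb{X}$; the choice is irrelevant). $\mathbb{E}_x^\pi$ is expectation for the process $x_0,a_0,x_1,a_1,\dots$ with $x_0=x$, actions chosen by $\pi$, and transition probabilities $p$. The total cost is $$v^\pi(x):=\mathbb{E}_x^\pi\sum_{n=0}^\infty\Big(\prod_{k=0}^{n-1}\alpha(x_k,a_k)\Big)c(x_n,a_n)\in[0,\infty],$$ $v(x):=\inf_{\pi\in\Pi}v^\pi(x)$, and $\pi$ is total-cost optimal if $v^\pi(x)=v(x)$ for all $x\in\mathbb{X}$. A set-valued mapping $s\mapsto\Phi(s)\subseteq\mathbb{T}$ between metric spaces is compact-valued if every $\Phi(s)$ is compact, and continuous if for every open $O\subseteq\mathbb{T}$ the sets $\{s:\Phi(s)\subseteq O\}$ and $\{s:\Phi(s)\cap O\neq\emptyset\}$ are open. $q$ is weakly continuous if $(x,a)\mapsto\int f(y)\,q(dy|x,a)$ is continuous on $\mathrm{Gr}(A)$ for every bounded continuous $f:\mathbb{X}\to\mathbb{R}$. HV transformation. Let $\mu:\mathbb{X}\to[1,\infty)$ be a continuous function with $V\le\mu\le KV$ and $\mu(x)\ge V(x)+\int_{\mathbb{X}}\mu(y)\,q(dy|x,a)$ for all $(x,a)\in\mathrm{Gr}(A)$ (under the hypotheses of the claim such a $\mu$ exists), and choose a discount factor $\tilde\beta\in[(K-1)/K,1)$ with $\tilde\beta>0$. The new MDP has: - state space $\tilde{\mathbb{X}}:=\mathbb{X}\cup\{\tilde x\}$,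 where $\tilde x\notin\mathbb{X}$ is isolated from $\mathbb{X}$ (its distance to all points of $\mathbb{X}$ is bounded below by a positive constant); - action space $\tilde{\mathbb{A}}:=\mathbb{A}\cup\{\tilde a\}$, with $\tilde A(x):=A(x)$ for $x\in\mathbb{X}$ and $\tilde A(\tilde x):=\{\tilde a\}$; - costs $\tilde c(x,a):=c(x,a)/\mu(x)$ for $(x,a)\in\mathrm{Gr}(A)$ and $\tilde c(\tilde x,\tilde a):=0$; - transition probabilities, for $(x,a)\in\mathrm{Gr}(A)$: $\tilde p(B|x,a):=\frac{1}{\tilde\beta\mu(x)}\int_B\mu(y)\,q(dy|x,a)$ for $B\in\mathcal{B}(\mathbb{X})$, $\tilde p(\{\tilde x\}|x,a):=1-\frac{1}{\tilde\beta\mu(x)}\int_{\mathbb{X}}\mu(y)\,q(dy|x,a)$; and $\tilde p(\{\tilde x\}|\tilde x,\tilde a):=1$. Policies of the two MDPs are identified, since $\tilde a$ is the only action at $\tilde x$. $\tilde v^\pi(x):=\tilde{\mathbb{E}}_x^\pi\sum_{n=0}^\infty\tilde\beta^n\tilde c(x_n,a_n)$ is the expected total discounted cost in the new MDP, and $\pi$ is $\tilde\beta$-optimal if $\tilde v^\pi(x)=\inf_{\pi'}\tilde v^{\pi'}(x)$ for all $x\in\tilde{\mathbb{X}}$. *)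

theory Defs
  imports "HOL-Probability.Probability"
begin

section \<open>Semicontinuity and set-valued mappings\<close>

definition lower_semicontinuous_on :: "'b::topological_space set \<Rightarrow> ('b \<Rightarrow> real) \<Rightarrow> bool" where
  "lower_semicontinuous_on S f \<longleftrightarrow>
     (\<forall>z\<in>S. \<forall>r<f z. eventually (\<lambda>w. r < f w) (at z within S))"

definition continuous_set_valued ::
    "'b::topological_space set \<Rightarrow> 'c::topological_space set \<Rightarrow> ('b \<Rightarrow> 'c set) \<Rightarrow> bool" where
  "continuous_set_valued S T \<Phi> \<longleftrightarrow>
     (\<forall>U. openin (top_of_set T) U \<longrightarrow>
        openin (top_of_set S) {s\<in>S. \<Phi> s \<subseteq> U} \<and>
        openin (top_of_set S) {s\<in>S. \<Phi> s \<inter> U \<noteq> {}})"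


section \<open>Policies and trajectories\<close>

text \<open>
  The notions of this section are parametrised by a measurable state space \<open>MX\<close>, a measurable
  action space \<open>MA\<close> and the action sets \<open>A\<close>, because they are used for two decision processes.
  The history \<open>x\<^sub>0 a\<^sub>0 \<dots> x\<^sub>n\<close> is split into the function \<open>h\<close> of the pairs \<open>(x\<^sub>k, a\<^sub>k)\<close>, \<open>k < n\<close>,
  and the current state; \<open>\<pi> n h x\<close> is the law of \<open>a\<^sub>n\<close>.
\<close>

type_synonym ('x, 'a) policy = "nat \<Rightarrow> (nat \<Rightarrow> 'x \<times> 'a) \<Rightarrow> 'x \<Rightarrow> 'a measure"

definition policies :: "'x measure \<Rightarrow> 'a measure \<Rightarrow> ('x \<Rightarrow> 'a set) \<Rightarrow> ('x, 'a) policy set" where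
  "policies MX MA A = {\<pi>. \<forall>n.
     (\<lambda>(h, x). \<pi> n h x) \<in> PiM {0..<n} (\<lambda>_. MX \<Otimes>\<^sub>M MA) \<Otimes>\<^sub>M MX \<rightarrow>\<^sub>M prob_algebra MA \<and>
     (\<forall>h\<in>space (PiM {0..<n} (\<lambda>_. MX \<Otimes>\<^sub>M MA)). \<forall>x\<in>space MX. emeasure (\<pi> n h x) (A x) = 1)}"

definition selectors :: "'x measure \<Rightarrow> 'a measure \<Rightarrow> ('x \<Rightarrow> 'a set) \<Rightarrow> ('x \<Rightarrow> 'a) set" where
  "selectors MX MA A = {\<phi> \<in> MX \<rightarrow>\<^sub>M MA. \<forall>x\<in>space MX. \<phi> x \<in> A x}"

definition stationary :: "'a measure \<Rightarrow> ('x \<Rightarrow> 'a) \<Rightarrow> ('x, 'a) policy" where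
  "stationary MA \<phi> = (\<lambda>n h x. return MA (\<phi> x))"

text \<open>
  Conditional law of \<open>(x\<^sub>n, a\<^sub>n)\<close> given the preceding pairs, for initial state \<open>x\<close> and transition
  probabilities \<open>p\<close>. The trajectory law is the Ionescu-Tulcea measure of these kernels.
\<close>

definition step_kernel ::
    "'x measure \<Rightarrow> 'a measure \<Rightarrow> ('x \<times> 'a \<Rightarrow> 'x measure) \<Rightarrow> ('x, 'a) policy \<Rightarrow> 'x \<Rightarrow>
     nat \<Rightarrow> (nat \<Rightarrow> 'x \<times> 'a) \<Rightarrow> ('x \<times> 'a) measure" where
  "step_kernel MX MA p \<pi> x n h =
     (if n = 0 then return MX x else p (h (n - 1))) \<bind>
       (\<lambda>y. \<pi> n h y \<bind> (\<lambda>a. return (MX \<Otimes>\<^sub>M MA) (y, a)))"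

definition trajectory_law ::
    "'x measure \<Rightarrow> 'a measure \<Rightarrow> ('x \<times> 'a \<Rightarrow> 'x measure) \<Rightarrow> ('x, 'a) policy \<Rightarrow> 'x \<Rightarrow>
     (nat \<Rightarrow> 'x \<times> 'a) measure" where
  "trajectory_law MX MA p \<pi> x =
     projective_family.lim UNIV
       (Ionescu_Tulcea.CI (step_kernel MX MA p \<pi> x) (\<lambda>_. MX \<Otimes>\<^sub>M MA)) (\<lambda>_. MX \<Otimes>\<^sub>M MA)"


section \<open>Total cost for kernels that need not be stochastic\<close>

definition kernel_op ::
    "('x \<times> 'a \<Rightarrow> 'x measure) \<Rightarrow> ('x \<Rightarrow> 'a) \<Rightarrow> ('x \<Rightarrow> ennreal) \<Rightarrow> 'x \<Rightarrow> ennreal" where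
  "kernel_op q \<phi> u = (\<lambda>x. \<integral>\<^sup>+ y. u y \<partial>q (x, \<phi> x))"

definition kernel_mass :: "('x \<times> 'a \<Rightarrow> 'x measure) \<Rightarrow> 'x \<times> 'a \<Rightarrow> ennreal" where
  "kernel_mass q z = emeasure (q z) (space (q z))"

text \<open>
  Outside of the set \<open>G\<close> of feasible pairs, which the trajectories leave with probability zero,
  the value is irrelevant; it is set to \<open>p0\<close> to obtain a kernel on the whole product space.
\<close>

definition normalized_kernel ::
    "('x \<times> 'a) set \<Rightarrow> 'x measure \<Rightarrow> ('x \<times> 'a \<Rightarrow> 'x measure) \<Rightarrow> 'x \<times> 'a \<Rightarrow> 'x measure" where
  "normalized_kernel G p0 q z =
     (if z \<in> G \<and> kernel_mass q z \<noteq> 0 then scale_measure (inverse (kernel_mass q z)) (q z) else p0)"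

text \<open>The cost \<open>c\<close> and the mass \<open>\<alpha>\<close> only matter on \<open>G\<close>, by the remark above.\<close>

definition total_cost ::
    "'x measure \<Rightarrow> 'a measure \<Rightarrow> ('x \<Rightarrow> 'a set) \<Rightarrow> ('x \<times> 'a \<Rightarrow> real) \<Rightarrow>
     ('x \<times> 'a \<Rightarrow> 'x measure) \<Rightarrow> 'x measure \<Rightarrow> ('x, 'a) policy \<Rightarrow> 'x \<Rightarrow> ennreal" where
  "total_cost MX MA A c q p0 \<pi> x =
     (\<integral>\<^sup>+ \<omega>. (\<Sum>n. (\<Prod>k<n. kernel_mass q (\<omega> k)) * ennreal (c (\<omega> n)))
        \<partial>trajectory_law MX MA (normalized_kernel (Sigma (space MX) A) p0 q) \<pi> x)"

definition total_value ::
    "'x measure \<Rightarrow> 'a measure \<Rightarrow> ('x \<Rightarrow> 'a set) \<Rightarrow> ('x \<times> 'a \<Rightarrow> real) \<Rightarrow>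
     ('x \<times> 'a \<Rightarrow> 'x measure) \<Rightarrow> 'x measure \<Rightarrow> 'x \<Rightarrow> ennreal" where
  "total_value MX MA A c q p0 x = (INF \<pi>\<in>policies MX MA A. total_cost MX MA A c q p0 \<pi> x)"

definition total_cost_optimal ::
    "'x measure \<Rightarrow> 'a measure \<Rightarrow> ('x \<Rightarrow> 'a set) \<Rightarrow> ('x \<times> 'a \<Rightarrow> real) \<Rightarrow>
     ('x \<times> 'a \<Rightarrow> 'x measure) \<Rightarrow> 'x measure \<Rightarrow> ('x, 'a) policy \<Rightarrow> bool" where
  "total_cost_optimal MX MA A c q p0 \<pi> \<longleftrightarrow>
     (\<forall>x\<in>space MX. total_cost MX MA A c q p0 \<pi> x = total_value MX MA A c q p0 x)"


section \<open>Discounted cost\<close>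

definition discounted_cost ::
    "'x measure \<Rightarrow> 'a measure \<Rightarrow> ('x \<times> 'a \<Rightarrow> real) \<Rightarrow> ('x \<times> 'a \<Rightarrow> 'x measure) \<Rightarrow> real \<Rightarrow>
     ('x, 'a) policy \<Rightarrow> 'x \<Rightarrow> ennreal" where
  "discounted_cost MX MA c p \<beta> \<pi> x =
     (\<integral>\<^sup>+ \<omega>. (\<Sum>n. ennreal (\<beta> ^ n) * ennreal (c (\<omega> n))) \<partial>trajectory_law MX MA p \<pi> x)"

definition discount_optimal ::
    "'x measure \<Rightarrow> 'a measure \<Rightarrow> ('x \<Rightarrow> 'a set) \<Rightarrow> ('x \<times> 'a \<Rightarrow> real) \<Rightarrow>
     ('x \<times> 'a \<Rightarrow> 'x measure) \<Rightarrow> real \<Rightarrow> ('x, 'a) policy \<Rightarrow> bool" where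
  "discount_optimal MX MA A c p \<beta> \<pi> \<longleftrightarrow>
     (\<forall>x\<in>space MX. discounted_cost MX MA c p \<beta> \<pi> x =
        (INF \<pi>'\<in>policies MX MA A. discounted_cost MX MA c p \<beta> \<pi>' x))"


section \<open>The HV transformation\<close>

text \<open>
  \<^const>\<open>None\<close> is the added point, both for states and for actions. As it is isolated, the following is
  the Borel \<open>\<sigma>\<close>-algebra of the enlarged space when \<open>M\<close> carries the Borel \<open>\<sigma>\<close>-algebra.
\<close>

definition adjoin_point :: "'b measure \<Rightarrow> 'b option measure" where
  "adjoin_point M = sigma (insert None (Some ` space M)) (insert {None} ((`) Some ` sets M))"

definition hv_actions :: "('x \<Rightarrow> 'a set) \<Rightarrow> 'x option \<Rightarrow> 'a option set" where
  "hv_actions A s = (case s of None \<Rightarrow> {None} | Some x \<Rightarrow> Some ` A x)"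

definition hv_cost :: "('x \<Rightarrow> real) \<Rightarrow> ('x \<times> 'a \<Rightarrow> real) \<Rightarrow> 'x option \<times> 'a option \<Rightarrow> real" where
  "hv_cost \<mu> c z = (case z of (Some x, Some a) \<Rightarrow> c (x, a) / \<mu> x | _ \<Rightarrow> 0)"

text \<open>
  On infeasible pairs, whose value is irrelevant, the transition is to \<^const>\<open>None\<close>. The difference
  in \<^typ>\<open>ennreal\<close> is a true one whenever the transformed masses are at most one.
\<close>

definition hv_kernel ::
    "'x measure \<Rightarrow> ('x \<Rightarrow> 'a set) \<Rightarrow> ('x \<times> 'a \<Rightarrow> 'x measure) \<Rightarrow> ('x \<Rightarrow> real) \<Rightarrow> real \<Rightarrow>
     'x option \<times> 'a option \<Rightarrow> 'x option measure" where
  "hv_kernel MX A q \<mu> \<beta> z = (case z of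
     (Some x, Some a) \<Rightarrow>
       if (x, a) \<in> Sigma (space MX) A then
         measure_of (space (adjoin_point MX)) (sets (adjoin_point MX))
           (\<lambda>B. (\<integral>\<^sup>+ y. ennreal (\<mu> y) * indicator (Some -` B) y \<partial>q (x, a)) / ennreal (\<beta> * \<mu> x)
              + (1 - (\<integral>\<^sup>+ y. ennreal (\<mu> y) \<partial>q (x, a)) / ennreal (\<beta> * \<mu> x)) * indicator B None)
       else return (adjoin_point MX) None
   | _ \<Rightarrow> return (adjoin_point MX) None)"

text \<open>
  \<open>hv_optimal\<close> says that the stationary policy \<open>\<phi>\<close>, which has to play \<^const>\<open>None\<close> in the added
  state, is optimal for the transformed process with discount factor \<open>\<beta>\<close>.
\<close>

definition hv_optimal ::
    "'x measure \<Rightarrow> 'a measure \<Rightarrow> ('x \<Rightarrow> 'a set) \<Rightarrow> ('x \<times> 'a \<Rightarrow> real) \<Rightarrow>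
     ('x \<times> 'a \<Rightarrow> 'x measure) \<Rightarrow> ('x \<Rightarrow> real) \<Rightarrow> real \<Rightarrow> ('x \<Rightarrow> 'a) \<Rightarrow> bool" where
  "hv_optimal MX MA A c q \<mu> \<beta> \<phi> \<longleftrightarrow>
     discount_optimal (adjoin_point MX) (adjoin_point MA) (hv_actions A) (hv_cost \<mu> c)
       (hv_kernel MX A q \<mu> \<beta>) \<beta> (stationary (adjoin_point MA) (map_option \<phi>))"

end

theory Submission
  imports Defs
begin

text \<open>
  The costs are nonnegative, so this is positive dynamic programming. Let \<open>v\<^sub>n\<close> be the \<open>n\<close>-horizon values
  of value iteration from \<open>0\<close> and \<open>w\<close> their increasing limit. Iterating the optimality inequality along
  a trajectory gives \<open>v\<^sub>n \<le> v\<^sup>\<pi>\<close> for every policy \<open>\<pi>\<close>, hence \<open>w \<le> v\<close>. Weak continuity and the compact action sets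
  make all these functions lower semicontinuous; by compactness the minima commute with the
  increasing limit, so \<open>w\<close> solves the optimality equation and a measurable selector \<open>\<phi>\<close> attains it.
  Iterating this equation along \<open>\<phi>\<close> gives \<open>v\<^sup>\<phi> \<le> w\<close>, and therefore \<open>v = w = v\<^sup>\<phi>\<close>.

  The transformation divides by \<open>\<mu>\<close>: if \<open>u\<close> satisfies the inequalities above for the original
  process, \<open>u/\<mu>\<close> (with value \<open>0\<close> at the added point) satisfies them for the transformed one. Hence the
  two values and the two costs of a stationary policy differ by the same factor, and it is not
  necessary to match the general policies of the two processes.
\<close>

section \<open>Lower semicontinuity and measurable selection\<close>

text \<open>The value \<open>v\<close> may be infinite, so the dynamic programming argument lives in
  \<open>ennreal\<close> and uses only sums, suprema and inequalities; nothing is cancelled there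
  except positive real factors. The lower bound has to cover randomized, history-dependent policies,
  but it never inspects how an action was drawn: the one-step inequality holds for each feasible
  action, hence also after averaging, and the terminal term vanishes because the iteration starts
  from 0. The upper bound requires one Borel selector of minimizers, and this is the delicate point:
  the objective is merely lower semicontinuous and the fibre \<open>A x\<close> moves with
  \<open>x\<close>, so the selector is built from compactness by successive minimization. The second
  obstacle is that weak continuity speaks of bounded continuous integrands whereas the iterates are
  neither; increasing approximation by such integrands closes the gap. Total and discounted cost are
  treated at once as a cost weighted by a product of factors along the trajectory, namely kernel
  masses in one case and the constant \<beta> in the other.\<close>

definition lsc_on :: "'b::topological_space set \<Rightarrow> ('b \<Rightarrow> ennreal) \<Rightarrow> bool" where
  "lsc_on S f \<longleftrightarrow> (\<forall>r. openin (top_of_set S) {z\<in>S. r < f z})"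

lemma lsc_on_cong: "(\<And>z. z \<in> S \<Longrightarrow> f z = g z) \<Longrightarrow> lsc_on S f \<longleftrightarrow> lsc_on S g"
  unfolding lsc_on_def by (simp cong: conj_cong)

lemma lsc_on_continuous:
  assumes "continuous_on S f" shows "lsc_on S f"
  unfolding lsc_on_def
proof
  fix r
  have "openin (top_of_set S) (S \<inter> f -` {r<..})"
    by (rule continuous_openin_preimage_gen[OF assms]) simp
  then show "openin (top_of_set S) {z \<in> S. r < f z}"
    by (simp add: Int_def vimage_def)
qed

lemma lsc_on_SUP:
  assumes "\<And>i. i \<in> I \<Longrightarrow> lsc_on S (f i)" shows "lsc_on S (\<lambda>z. SUP i\<in>I. f i z)"
  unfolding lsc_on_def
proof
  fix r
  have "{z \<in> S. r < (SUP i\<in>I. f i z)} = (\<Union>i\<in>I. {z \<in> S. r < f i z})"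
    by (auto simp: less_SUP_iff)
  with assms show "openin (top_of_set S) {z \<in> S. r < (SUP i\<in>I. f i z)}"
    by (auto simp: lsc_on_def)
qed

lemma lsc_on_measurable:
  fixes f :: "'b::topological_space \<Rightarrow> ennreal"
  assumes "lsc_on S f" shows "f \<in> borel_measurable (restrict_space borel S)"
proof (rule borel_measurableI_greater)
  fix r
  obtain T where "open T" "{z \<in> S. r < f z} = S \<inter> T"
    using assms by (auto simp: lsc_on_def openin_open)
  then show "{z \<in> space (restrict_space borel S). r < f z} \<in> sets (restrict_space borel S)"
    by (auto simp: space_restrict_space sets_restrict_space)
qed

text \<open>The approximants are the Lipschitz regularisations of the truncations of \<open>u\<close>.\<close>

lemma lsc_on_approx:
  fixes S :: "'b::metric_space set"
  assumes u: "lsc_on S u"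
  obtains f :: "nat \<Rightarrow> 'b \<Rightarrow> real"
  where "\<And>n. continuous_on S (f n)" "\<And>n z. z \<in> S \<Longrightarrow> 0 \<le> f n z" "\<And>n z. z \<in> S \<Longrightarrow> f n z \<le> real n"
    "\<And>z. z \<in> S \<Longrightarrow> incseq (\<lambda>n. f n z)" "\<And>z. z \<in> S \<Longrightarrow> u z = (SUP n. ennreal (f n z))"
proof
  define m where "m n y = enn2real (min (of_nat n) (u y))" for n :: nat and y
  \<comment> \<open>Truncation at \<open>n\<close> keeps the function bounded and real even where
    \<open>u\<close> is infinite, and the slope \<open>n\<close> makes it Lipschitz. Both grow with
    \<open>n\<close>, which makes the sequence increasing.\<close>
  define f where "f n z = (INF y\<in>S. m n y + real n * dist z y)" for n z
  have m_ennreal: "ennreal (m n y) = min (of_nat n) (u y)" for n y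
    unfolding m_def by (intro ennreal_enn2real) (simp add: min_less_iff_disj of_nat_less_top)
  have m0: "0 \<le> m n y" for n y by (simp add: m_def)
  have mn: "m n y \<le> real n" for n y
    using m_ennreal[of n y] by (metis ennreal_le_iff ennreal_of_nat_eq_real_of_nat min.cobounded1 of_nat_0_le_iff)
  have mono_m: "m k y \<le> m n y" if "k \<le> n" for k n y
    using that by (intro ennreal_le_iff[THEN iffD1, OF m0]) (auto simp: m_ennreal min_le_iff_disj intro: min.mono)
  have bdd: "bdd_below ((\<lambda>y. m n y + real n * dist z y) ` S)" for n z
    by (rule bdd_belowI2[of _ 0]) (simp add: m0)
  have le: "f n z \<le> m n y + real n * dist z y" if "y \<in> S" for n z y
    unfolding f_def by (rule cINF_lower[OF bdd that])
  have ge: "r \<le> f n z" if "S \<noteq> {}" "\<And>y. y \<in> S \<Longrightarrow> r \<le> m n y + real n * dist z y" for r n z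
    unfolding f_def by (rule cINF_greatest[OF that])
  show "0 \<le> f n z" if "z \<in> S" for n z
    by (rule ge) (use that m0 in auto)
  show f_le: "f n z \<le> real n" if "z \<in> S" for n z
    using le[OF that, of n z] mn[of n z] by simp
  show "continuous_on S (f n)" for n
  proof -
    have half: "f n z \<le> f n w + real n * dist z w" if "z \<in> S" "w \<in> S" for z w
    proof -
      have "f n z - real n * dist z w \<le> f n w"
      proof (rule ge)
        fix y assume "y \<in> S"
        have "real n * dist z y \<le> real n * (dist z w + dist w y)"
          by (intro mult_left_mono dist_triangle) simp
        then show "f n z - real n * dist z w \<le> m n y + real n * dist w y"
          using le[OF \<open>y \<in> S\<close>, of n z] by (simp add: algebra_simps)
      qed (use that in auto)
      then show ?thesis by simp
    qed
    have "(real n)-lipschitz_on S (f n)"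
    proof (rule lipschitz_onI)
      fix z w assume "z \<in> S" "w \<in> S"
      then show "dist (f n z) (f n w) \<le> real n * dist z w"
        using half[of z w] half[of w z] by (simp add: dist_real_def dist_commute abs_le_iff)
    qed simp
    then show ?thesis by (rule lipschitz_on_continuous_on)
  qed
  show "incseq (\<lambda>n. f n z)" if "z \<in> S" for z
    unfolding incseq_Suc_iff
  proof (intro allI, rule ge)
    fix k y assume "y \<in> S"
    have "real k * dist z y \<le> real (Suc k) * dist z y" by (rule mult_right_mono) auto
    then show "f k z \<le> m (Suc k) y + real (Suc k) * dist z y"
      using le[OF \<open>y \<in> S\<close>, of k z] mono_m[of k "Suc k" y] by linarith
  qed (use that in auto)
  show "u z = (SUP n. ennreal (f n z))" if z: "z \<in> S" for z
  proof (rule antisym)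
    show "(SUP n. ennreal (f n z)) \<le> u z"
    proof (rule SUP_least)
      fix n
      have "ennreal (f n z) \<le> ennreal (m n z)" using le[OF z, of n z] by (intro ennreal_leI) simp
      then show "ennreal (f n z) \<le> u z" by (simp add: m_ennreal)
    qed
    show "u z \<le> (SUP n. ennreal (f n z))"
      unfolding le_SUP_iff
    proof (intro allI impI)
      fix y assume "y < u z"
      then obtain q :: rat where q: "y < ennreal (real_of_rat q)" "ennreal (real_of_rat q) < u z"
        using ennreal_rat_dense by blast
      define s where "s = real_of_rat q"
      have s: "y < ennreal s" "ennreal s < u z" using q by (auto simp: s_def)
      then have "0 < s" by (metis ennreal_eq_0_iff not_le not_less_zero)
      obtain d where d: "d > 0" "\<And>w. w \<in> S \<Longrightarrow> dist w z < d \<Longrightarrow> ennreal s < u w"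
      proof -
        have "openin (top_of_set S) {w \<in> S. ennreal s < u w}"
          using u by (simp add: lsc_on_def)
        then obtain e where "e > 0" "\<forall>w\<in>S. dist w z < e \<longrightarrow> w \<in> {w \<in> S. ennreal s < u w}"
          using z s(2) unfolding openin_euclidean_subtopology_iff by blast
        then show ?thesis using that by blast
      qed
      \<comment> \<open>Exceeding \<open>s\<close> ensures that the truncation does not cut below
        \<open>s\<close> near \<open>z\<close>; exceeding \<open>s / d\<close> ensures that at
        distance \<open>d\<close> or more the penalty alone reaches \<open>s\<close>.\<close>
      obtain n :: nat where "max s (s / d) < real n" using reals_Archimedean2 by blast
      then have n: "s \<le> real n" "s \<le> real n * d" using \<open>d > 0\<close> by (auto simp: field_simps)
      have "s \<le> f n z"
      proof (rule ge)
        fix w assume w: "w \<in> S"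
        show "s \<le> m n w + real n * dist z w"
        proof (cases "dist w z < d")
          case True
          then have "ennreal s \<le> ennreal (m n w)"
            using d(2)[OF w] n(1) by (auto simp: m_ennreal ennreal_of_nat_eq_real_of_nat ennreal_leI less_imp_le)
          then have "s \<le> m n w" using m0 by (simp add: ennreal_le_iff)
          then show ?thesis by (simp add: add_increasing2)
        next
          case False
          then have "real n * d \<le> real n * dist z w" by (intro mult_left_mono) (auto simp: dist_commute)
          then show ?thesis using n(2) m0[of n w] by linarith
        qed
      qed (use z in auto)
      then show "\<exists>i\<in>UNIV. y < ennreal (f i z)"
        using s(1) by (metis UNIV_I ennreal_leI order.strict_trans2)
    qed
  qed
qed

text \<open>Approximating both summands from below by continuous functions turns the sum into a
  supremum of continuous functions, so that a bound on the sum never has to be split between the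
  summands.\<close>

lemma lsc_on_add:
  fixes f g :: "'b::metric_space \<Rightarrow> ennreal"
  assumes "lsc_on S f" "lsc_on S g" shows "lsc_on S (\<lambda>z. f z + g z)"
proof -
  obtain f' :: "nat \<Rightarrow> 'b \<Rightarrow> real" where f': "\<And>n. continuous_on S (f' n)" "\<And>z. z \<in> S \<Longrightarrow> incseq (\<lambda>n. f' n z)"
    "\<And>z. z \<in> S \<Longrightarrow> f z = (SUP n. ennreal (f' n z))"
    using lsc_on_approx[OF assms(1)] by metis
  obtain g' :: "nat \<Rightarrow> 'b \<Rightarrow> real" where g': "\<And>n. continuous_on S (g' n)" "\<And>z. z \<in> S \<Longrightarrow> incseq (\<lambda>n. g' n z)"
    "\<And>z. z \<in> S \<Longrightarrow> g z = (SUP n. ennreal (g' n z))"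
    using lsc_on_approx[OF assms(2)] by metis
  have "f z + g z = (SUP n. ennreal (f' n z) + ennreal (g' n z))" if "z \<in> S" for z
    using f'(2)[OF that] g'(2)[OF that]
    by (subst ennreal_SUP_add) (auto simp: f'(3) g'(3) that incseq_def intro!: ennreal_leI)
  moreover have "lsc_on S (\<lambda>z. SUP n. ennreal (f' n z) + ennreal (g' n z))"
    by (intro lsc_on_SUP lsc_on_continuous continuous_on_add continuous_on_ennreal f' g')
  ultimately show ?thesis by (subst lsc_on_cong)
qed

text \<open>The increasing approximants of \<open>u\<close> are continuous and lie between 0 and
  \<open>n\<close>, so \<open>weak\<close> applies to each of them. Monotone convergence then writes
  the integral of \<open>u\<close> as a supremum of functions continuous in
  \<open>z\<close>.\<close>

lemma lsc_on_nn_integral: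
  fixes X :: "'b::metric_space set" and q :: "'z::topological_space \<Rightarrow> 'b measure"
  assumes u: "lsc_on X u"
    and finite: "\<And>z. z \<in> Z \<Longrightarrow> finite_measure (q z)"
    and sets: "\<And>z. z \<in> Z \<Longrightarrow> sets (q z) = sets (restrict_space borel X)"
    and weak: "\<And>f :: 'b \<Rightarrow> real. continuous_on X f \<Longrightarrow> bounded (f ` X) \<Longrightarrow>
      continuous_on Z (\<lambda>z. \<integral>y. f y \<partial>q z)"
  shows "lsc_on Z (\<lambda>z. \<integral>\<^sup>+y. u y \<partial>q z)"
proof -
  obtain f :: "nat \<Rightarrow> 'b \<Rightarrow> real" where f: "\<And>n. continuous_on X (f n)" "\<And>n z. z \<in> X \<Longrightarrow> 0 \<le> f n z"
    "\<And>n z. z \<in> X \<Longrightarrow> f n z \<le> real n"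
    "\<And>z. z \<in> X \<Longrightarrow> incseq (\<lambda>n. f n z)" "\<And>z. z \<in> X \<Longrightarrow> u z = (SUP n. ennreal (f n z))"
    using lsc_on_approx[OF u] by metis
  have "(\<integral>\<^sup>+y. u y \<partial>q z) = (SUP n. ennreal (\<integral>y. f n y \<partial>q z))" if z: "z \<in> Z" for z
  proof -
    interpret finite_measure "q z" by (rule finite[OF z])
    have sp: "space (q z) = X" using sets_eq_imp_space_eq[OF sets[OF z]] by (simp add: space_restrict_space)
    have [measurable]: "f n \<in> borel_measurable (q z)" for n
      by (subst measurable_cong_sets[OF sets[OF z] refl]) (rule borel_measurable_continuous_on_restrict[OF f(1)])
    have int: "integrable (q z) (f n)" for n
      using f(2,3) by (intro integrable_const_bound[where B="real n"]) (auto simp: sp)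
    have "(\<integral>\<^sup>+y. u y \<partial>q z) = (\<integral>\<^sup>+y. (SUP n. ennreal (f n y)) \<partial>q z)"
      by (intro nn_integral_cong) (simp add: sp f(5))
    also have "\<dots> = (SUP n. \<integral>\<^sup>+y. ennreal (f n y) \<partial>q z)"
      using f(4) by (intro nn_integral_monotone_convergence_SUP_AE)
        (auto simp: sp incseq_def intro!: AE_I2 ennreal_leI)
    also have "\<dots> = (SUP n. ennreal (\<integral>y. f n y \<partial>q z))"
      by (intro SUP_cong refl nn_integral_eq_integral int AE_I2) (simp add: sp f(2))
    finally show ?thesis .
  qed
  moreover have "bounded (f n ` X)" for n
    using f(2,3) by (intro boundedI[of _ "real n"]) auto
  then have "lsc_on Z (\<lambda>z. SUP n. ennreal (\<integral>y. f n y \<partial>q z))"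
    by (intro lsc_on_SUP lsc_on_continuous continuous_on_ennreal weak f)
  ultimately show ?thesis by (subst lsc_on_cong)
qed

section \<open>Minimization over compact sets and over fibres that move with the state\<close>

lemma lsc_on_compact_sublevel:
  fixes K :: "'b::t2_space set"
  assumes "compact K" "lsc_on K f" shows "compact {a\<in>K. f a \<le> r}"
proof -
  obtain T where T: "open T" "{a\<in>K. r < f a} = K \<inter> T"
    using assms(2) by (auto simp: lsc_on_def openin_open)
  have "{a\<in>K. f a \<le> r} = K - {a\<in>K. r < f a}" by (auto simp: not_less)
  then have "{a\<in>K. f a \<le> r} = K - T" unfolding T(2) by blast
  then show ?thesis using compact_diff[OF assms(1) T(1)] by simp
qed

text \<open>Without a minimizer the sets \<open>{a. f b < f a}\<close> would form an open cover of
  \<open>K\<close>. Among the finitely many \<open>b\<close> of a subcover, the one with the least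
  value is covered by none of them.\<close>

lemma lsc_on_attains_min:
  assumes "compact K" "K \<noteq> {}" "lsc_on K f"
  shows "\<exists>a\<in>K. \<forall>b\<in>K. f a \<le> f b"
proof (rule ccontr)
  assume "\<not> ?thesis"
  then have no: "\<And>a. a \<in> K \<Longrightarrow> \<exists>b\<in>K. f b < f a" by (auto simp: not_le)
  have "\<forall>b. \<exists>T. open T \<and> {a\<in>K. f b < f a} = K \<inter> T"
    using assms(3) by (auto simp: lsc_on_def openin_open)
  then obtain T where T: "\<And>b. open (T b)" "\<And>b. {a\<in>K. f b < f a} = K \<inter> T b" by metis
  have "K \<subseteq> (\<Union>b\<in>K. T b)" using no T(2) by blast
  then obtain D where D: "D \<subseteq> K" "finite D" "K \<subseteq> (\<Union>b\<in>D. T b)"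
    using compactE_image[OF assms(1), of K T] T(1) by metis
  then have "D \<noteq> {}" using assms(2) by auto
  then obtain b where b: "b \<in> D" "\<And>a. a \<in> D \<Longrightarrow> f b \<le> f a"
    using \<open>finite D\<close> by (metis arg_min_if_finite(1) arg_min_least)
  then obtain a where "a \<in> D" "b \<in> T a" using D by blast
  then have "f a < f b" using T(2)[of a] D(1) b(1) by blast
  with b(2)[OF \<open>a \<in> D\<close>] show False by simp
qed

lemma lsc_on_section:
  assumes "lsc_on (Sigma X A) g" "x \<in> X" shows "lsc_on (A x) (\<lambda>a. g (x, a))"
  unfolding lsc_on_def
proof
  fix r
  obtain T where T: "open T" "{z \<in> Sigma X A. r < g z} = Sigma X A \<inter> T"
    using assms(1) by (auto simp: lsc_on_def openin_open)
  have "{a \<in> A x. r < g (x, a)} = A x \<inter> Pair x -` T"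
    using T(2) assms(2) by blast
  moreover have "open (Pair x -` T)"
    by (rule open_vimage[OF T(1)]) (intro continuous_intros)
  ultimately show "openin (top_of_set (A x)) {a \<in> A x. r < g (x, a)}"
    by (auto simp: openin_open)
qed

text \<open>A tube argument along a moving fibre. The closed set \<open>F\<close> is a parameter
  because \<open>F = UNIV\<close> yields semicontinuity of the minimum, while general
  \<open>F\<close> yields the sublevel conditions of the selection theorem. Actions outside
  \<open>F\<close> are covered by \<open>- F\<close>, where nothing has to be shown.\<close>

lemma openin_all_fibre_greater:
  fixes A :: "'x::topological_space \<Rightarrow> 'a::topological_space set"
  assumes g: "lsc_on (Sigma X A) g" and K: "\<And>x. x \<in> X \<Longrightarrow> compact (A x)"
    and upper: "\<And>U. open U \<Longrightarrow> openin (top_of_set X) {x\<in>X. A x \<subseteq> U}" and F: "closed F"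
  shows "openin (top_of_set X) {x\<in>X. \<forall>a\<in>A x \<inter> F. r < g (x, a)}" (is "openin _ ?S")
proof (subst openin_subopen, intro ballI)
  fix x assume x: "x \<in> ?S"
  have "\<forall>a\<in>A x. \<exists>P W. open P \<and> open W \<and> x \<in> P \<and> a \<in> W \<and> (\<forall>x'\<in>X \<inter> P. \<forall>b\<in>A x' \<inter> F \<inter> W. r < g (x', b))"
  proof
    fix a assume a: "a \<in> A x"
    show "\<exists>P W. open P \<and> open W \<and> x \<in> P \<and> a \<in> W \<and> (\<forall>x'\<in>X \<inter> P. \<forall>b\<in>A x' \<inter> F \<inter> W. r < g (x', b))"
    proof (cases "a \<in> F")
      case False
      then show ?thesis using F by (intro exI[of _ UNIV] exI[of _ "- F"]) auto
    next
      case True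
      obtain T where T: "open T" "{z \<in> Sigma X A. r < g z} = Sigma X A \<inter> T"
        using g by (auto simp: lsc_on_def openin_open)
      have "(x, a) \<in> T" using T(2) x a True by blast
      then obtain P W where PW: "open P" "open W" "(x, a) \<in> P \<times> W" "P \<times> W \<subseteq> T"
        using T(1) by (metis open_prod_elim)
      have "r < g (x', b)" if "x' \<in> X \<inter> P" "b \<in> A x' \<inter> F \<inter> W" for x' b
      proof -
        have "(x', b) \<in> Sigma X A \<inter> T" using that PW(4) by auto
        then show ?thesis using T(2) by auto
      qed
      then show ?thesis using PW by (intro exI[of _ P] exI[of _ W]) auto
    qed
  qed
  then obtain P W where PW: "\<And>a. a \<in> A x \<Longrightarrow> open (P a) \<and> open (W a) \<and> x \<in> P a \<and> a \<in> W a \<and>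
      (\<forall>x'\<in>X \<inter> P a. \<forall>b\<in>A x' \<inter> F \<inter> W a. r < g (x', b))"
    by metis
  have "A x \<subseteq> (\<Union>a\<in>A x. W a)" using PW by blast
  then obtain D where D: "D \<subseteq> A x" "finite D" "A x \<subseteq> (\<Union>a\<in>D. W a)"
    using compactE_image[OF K, of x "A x" W] PW x by (metis (mono_tags, lifting) mem_Collect_eq)
  define U where "U = (\<Union>a\<in>D. W a)"
  \<comment> \<open>Finitely many sets \<open>W a\<close> cover the fibre over \<open>x\<close>;
    upper semicontinuity keeps the neighbouring fibres inside their union, so the finitely many
    local estimates apply to every action over \<open>N\<close>.\<close>
  define N where "N = {x'\<in>X. A x' \<subseteq> U} \<inter> (\<Inter>a\<in>D. P a)"
  have "openin (top_of_set X) N"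
    unfolding N_def U_def using D(1,2) PW by (intro openin_Int_open upper open_INT open_UN) blast+
  moreover have "x \<in> N" using x D PW unfolding N_def U_def by blast
  moreover have "N \<subseteq> ?S"
  proof
    fix x' assume x': "x' \<in> N"
    have "r < g (x', b)" if b: "b \<in> A x' \<inter> F" for b
    proof -
      obtain a where "a \<in> D" "b \<in> W a" using x' b unfolding N_def U_def by blast
      moreover have "x' \<in> X \<inter> P a" using x' \<open>a \<in> D\<close> unfolding N_def by blast
      ultimately show ?thesis using PW[of a] D(1) b by blast
    qed
    then show "x' \<in> ?S" using x' by (auto simp: N_def)
  qed
  ultimately show "\<exists>T. openin (top_of_set X) T \<and> x \<in> T \<and> T \<subseteq> ?S" by blast
qed

text \<open>Attainment of the minimum is what allows the strict inequality
  \<open>r < g (x, a)\<close> for all actions to pass to the infimum.\<close>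

lemma lsc_on_INF_fibre:
  fixes A :: "'x::topological_space \<Rightarrow> 'a::topological_space set"
  assumes g: "lsc_on (Sigma X A) g" and K: "\<And>x. x \<in> X \<Longrightarrow> compact (A x)"
    and ne: "\<And>x. x \<in> X \<Longrightarrow> A x \<noteq> {}"
    and upper: "\<And>U. open U \<Longrightarrow> openin (top_of_set X) {x\<in>X. A x \<subseteq> U}"
  shows "lsc_on X (\<lambda>x. INF a\<in>A x. g (x, a))"
  unfolding lsc_on_def
proof
  fix r
  have "r < (INF a\<in>A x. g (x, a)) \<longleftrightarrow> (\<forall>a\<in>A x. r < g (x, a))" if x: "x \<in> X" for x
  proof
    assume *: "\<forall>a\<in>A x. r < g (x, a)"
    obtain a where "a \<in> A x" "\<forall>b\<in>A x. g (x, a) \<le> g (x, b)"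
      using lsc_on_attains_min[OF K[OF x] ne[OF x] lsc_on_section[OF g x]] by blast
    then have "g (x, a) \<le> (INF a\<in>A x. g (x, a))" by (auto intro: INF_greatest)
    with * \<open>a \<in> A x\<close> show "r < (INF a\<in>A x. g (x, a))" by (auto intro: order.strict_trans2)
  qed (auto intro: order.strict_trans2 INF_lower)
  then have "{x \<in> X. r < (INF a\<in>A x. g (x, a))} = {x\<in>X. \<forall>a\<in>A x \<inter> UNIV. r < g (x, a)}"
    by auto
  then show "openin (top_of_set X) {x \<in> X. r < (INF a\<in>A x. g (x, a))}"
    using openin_all_fibre_greater[OF g K upper closed_UNIV] by simp
qed

lemma compact_decseq_Int_nonempty:
  fixes C :: "nat \<Rightarrow> 'a::t2_space set"
  assumes "\<And>k. compact (C k)" "\<And>k. C k \<noteq> {}" "\<And>k. C (Suc k) \<subseteq> C k"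
  shows "(\<Inter>k. C k) \<noteq> {}"
proof -
  have mono: "C n \<subseteq> C m" if "m \<le> n" for m n
    using assms(3) that by (rule lift_Suc_antimono_le)
  have "C 0 \<inter> (\<Inter>k\<in>UNIV. C k) \<noteq> {}"
  proof (rule compact_imp_fip_image)
    fix I :: "nat set" assume "finite I"
    then have "C (Max (insert 0 I)) \<subseteq> C 0 \<inter> (\<Inter>k\<in>I. C k)"
      by (intro Int_greatest INT_greatest mono) auto
    then show "C 0 \<inter> (\<Inter>k\<in>I. C k) \<noteq> {}" using assms(2) by blast
  qed (auto simp: assms(1) compact_imp_closed)
  then show ?thesis by blast
qed

text \<open>The sublevel sets of the \<open>g n\<close> at the limit of the minima are nonempty,
  compact and decreasing, so they share a point. This is the nontrivial half of exchanging minimum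
  and increasing limit.\<close>

lemma lsc_on_attains_limit_of_minima:
  fixes K :: "'a::t2_space set"
  assumes K: "compact K" "K \<noteq> {}" and g: "\<And>n. lsc_on K (g n)"
    and mono: "\<And>n a. a \<in> K \<Longrightarrow> g n a \<le> g (Suc n) a"
  shows "\<exists>a\<in>K. (SUP n. g n a) \<le> (SUP n. INF b\<in>K. g n b)"
proof -
  let ?r = "SUP n. INF b\<in>K. g n b"
  have "(\<Inter>n. {a\<in>K. g n a \<le> ?r}) \<noteq> {}"
  proof (rule compact_decseq_Int_nonempty)
    show "compact {a\<in>K. g n a \<le> ?r}" for n by (rule lsc_on_compact_sublevel[OF K(1) g])
    show "{a\<in>K. g n a \<le> ?r} \<noteq> {}" for n
    proof -
      obtain a where a: "a \<in> K" "\<forall>b\<in>K. g n a \<le> g n b" using lsc_on_attains_min[OF K g] by blast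
      then have "g n a \<le> (INF b\<in>K. g n b)" by (auto intro: INF_greatest)
      also have "\<dots> \<le> ?r" by (rule SUP_upper) simp
      finally show ?thesis using a(1) by blast
    qed
    show "{a\<in>K. g (Suc n) a \<le> ?r} \<subseteq> {a\<in>K. g n a \<le> ?r}" for n
      using mono by (auto intro: order.trans)
  qed
  then obtain a where "\<And>n. a \<in> K \<and> g n a \<le> ?r" by auto
  then show ?thesis by (auto intro: SUP_least)
qed

text \<open>Closed test sets fit compact values: the condition is stable under intersection with a
  fixed closed set and under decreasing intersections of compact sets, and for one-point values it
  says that preimages of closed sets are measurable.\<close>

definition hit_measurable :: "'x measure \<Rightarrow> ('x \<Rightarrow> 'a::topological_space set) \<Rightarrow> bool" where
  "hit_measurable N B \<longleftrightarrow> (\<forall>F. closed F \<longrightarrow> {x\<in>space N. B x \<inter> F \<noteq> {}} \<in> sets N)"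

text \<open>
  A minimizer over \<open>B x \<inter> F\<close> minimizes over \<open>B x\<close> as soon as each rational sublevel set
  that meets \<open>B x\<close> also meets \<open>B x \<inter> F\<close>. This makes the condition a countable one.
\<close>

lemma hit_measurable_argmin:
  fixes B :: "'x \<Rightarrow> 'a::topological_space set" and f :: "'x \<Rightarrow> 'a \<Rightarrow> ennreal"
  assumes B: "hit_measurable N B"
    and sub: "\<And>F r. closed F \<Longrightarrow> {x\<in>space N. \<exists>a\<in>B x \<inter> F. f x a \<le> r} \<in> sets N"
    and min: "\<And>x F. x \<in> space N \<Longrightarrow> closed F \<Longrightarrow> B x \<inter> F \<noteq> {} \<Longrightarrow>
      \<exists>a\<in>B x \<inter> F. \<forall>b\<in>B x \<inter> F. f x a \<le> f x b"
  shows "hit_measurable N (\<lambda>x. {a\<in>B x. \<forall>b\<in>B x. f x a \<le> f x b})"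
  unfolding hit_measurable_def
proof (intro allI impI)
  fix F :: "'a set" assume F: "closed F"
  let ?R = "\<lambda>r::rat. ennreal (real_of_rat r)"
  have "{a\<in>B x. \<forall>b\<in>B x. f x a \<le> f x b} \<inter> F \<noteq> {} \<longleftrightarrow>
    B x \<inter> F \<noteq> {} \<and> (\<forall>r. (\<exists>a\<in>B x \<inter> UNIV. f x a \<le> ?R r) \<longrightarrow> (\<exists>a\<in>B x \<inter> F. f x a \<le> ?R r))"
    if x: "x \<in> space N" for x
  proof (intro iffI)
    assume rhs: "B x \<inter> F \<noteq> {} \<and>
      (\<forall>r. (\<exists>a\<in>B x \<inter> UNIV. f x a \<le> ?R r) \<longrightarrow> (\<exists>a\<in>B x \<inter> F. f x a \<le> ?R r))"
    show "{a\<in>B x. \<forall>b\<in>B x. f x a \<le> f x b} \<inter> F \<noteq> {}"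
    proof
      assume empty: "{a\<in>B x. \<forall>b\<in>B x. f x a \<le> f x b} \<inter> F = {}"
      obtain c where c: "c \<in> B x \<inter> F" "\<forall>b\<in>B x \<inter> F. f x c \<le> f x b"
        using min[OF x F] rhs by blast
      then have "\<not> (\<forall>b\<in>B x. f x c \<le> f x b)" using empty by blast
      then obtain b where b: "b \<in> B x" "f x b < f x c" by (auto simp: not_le)
      then obtain r where r: "f x b < ?R r" "?R r < f x c" using ennreal_rat_dense by blast
      then obtain d where "d \<in> B x \<inter> F" "f x d \<le> ?R r" using rhs b(1) less_imp_le by blast
      then show False using c(2) r(2) by (meson leD order.trans)
    qed
  next
    assume "{a\<in>B x. \<forall>b\<in>B x. f x a \<le> f x b} \<inter> F \<noteq> {}"
    then obtain a where "a \<in> B x \<inter> F" "\<forall>b\<in>B x. f x a \<le> f x b" by blast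
    then show "B x \<inter> F \<noteq> {} \<and>
      (\<forall>r. (\<exists>a\<in>B x \<inter> UNIV. f x a \<le> ?R r) \<longrightarrow> (\<exists>a\<in>B x \<inter> F. f x a \<le> ?R r))"
      by (auto intro: order.trans)
  qed
  then have "{x\<in>space N. {a\<in>B x. \<forall>b\<in>B x. f x a \<le> f x b} \<inter> F \<noteq> {}} =
    {x\<in>space N. B x \<inter> F \<noteq> {} \<and> (\<forall>r. (\<exists>a\<in>B x \<inter> UNIV. f x a \<le> ?R r) \<longrightarrow> (\<exists>a\<in>B x \<inter> F. f x a \<le> ?R r))}"
    by blast
  also have "\<dots> \<in> sets N"
    using B F sub sub[OF closed_UNIV] unfolding hit_measurable_def
    by (intro sets.sets_Collect_conj sets.sets_Collect_countable_All sets.sets_Collect_imp) auto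
  finally show "{x\<in>space N. {a\<in>B x. \<forall>b\<in>B x. f x a \<le> f x b} \<inter> F \<noteq> {}} \<in> sets N" .
qed

text \<open>
  Minimizing in turn the distances to the points of a dense sequence shrinks \<open>B x\<close> to a single
  point, because a point of the space is determined by these distances.
\<close>

theorem measurable_selection_compact:
  fixes B :: "'x \<Rightarrow> 'a::polish_space set"
  assumes B: "hit_measurable N B" and K: "\<And>x. x \<in> space N \<Longrightarrow> compact (B x)"
    and ne: "\<And>x. x \<in> space N \<Longrightarrow> B x \<noteq> {}"
  shows "\<exists>\<phi>\<in>borel_measurable N. \<forall>x\<in>space N. \<phi> x \<in> B x"
proof -
  obtain D :: "'a set" where D: "countable D" "\<And>U. open U \<Longrightarrow> U \<noteq> {} \<Longrightarrow> \<exists>d\<in>D. d \<in> U"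
    using countable_dense_exists by blast
  have "D \<noteq> {}" using D(2)[of UNIV] by auto
  define d where "d = from_nat_into D"
  have dense: "\<exists>k. d k \<in> U" if "open U" "U \<noteq> {}" for U
    using D(2)[OF that] from_nat_into_surj[OF D(1)] unfolding d_def by metis
  define C where "C = rec_nat B (\<lambda>k B' x. {a\<in>B' x. \<forall>b\<in>B' x. ennreal (dist a (d k)) \<le> ennreal (dist b (d k))})"
  have C0: "C 0 = B" and CSuc: "C (Suc k) = (\<lambda>x. {a\<in>C k x. \<forall>b\<in>C k x. ennreal (dist a (d k)) \<le> ennreal (dist b (d k))})" for k
    by (simp_all add: C_def)
  have min: "\<exists>a\<in>S. \<forall>b\<in>S. ennreal (dist a e) \<le> ennreal (dist b e)" if "compact S" "S \<noteq> {}" for S and e :: 'a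
    using continuous_attains_inf[OF that, of "\<lambda>a. dist a e"]
    by (simp add: ennreal_le_iff continuous_on_dist)
  have C: "hit_measurable N (C k) \<and> (\<forall>x\<in>space N. compact (C k x) \<and> C k x \<noteq> {})" for k
  proof (induction k)
    case 0 then show ?case using B K ne by (simp add: C0)
  next
    case (Suc k)
    have closed_sub: "closed {a. ennreal (dist a e) \<le> r}" for e :: 'a and r
      by (intro closed_Collect_le continuous_on_ennreal continuous_intros)
    have "hit_measurable N (C (Suc k))"
      unfolding CSuc
    proof (rule hit_measurable_argmin)
      show "hit_measurable N (C k)" using Suc by simp
      fix F :: "'a set" assume F: "closed F"
      show "{x\<in>space N. \<exists>a\<in>C k x \<inter> F. ennreal (dist a (d k)) \<le> r} \<in> sets N" for r
      proof -
        have "{x\<in>space N. \<exists>a\<in>C k x \<inter> F. ennreal (dist a (d k)) \<le> r} =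
          {x\<in>space N. C k x \<inter> (F \<inter> {a. ennreal (dist a (d k)) \<le> r}) \<noteq> {}}" by blast
        also have "\<dots> \<in> sets N"
          using conjunct1[OF Suc] closed_Int[OF F closed_sub] by (simp add: hit_measurable_def)
        finally show ?thesis .
      qed
      show "\<exists>a\<in>C k x \<inter> F. \<forall>b\<in>C k x \<inter> F. ennreal (dist a (d k)) \<le> ennreal (dist b (d k))"
        if "x \<in> space N" "C k x \<inter> F \<noteq> {}" for x
        using Suc that F by (intro min compact_Int_closed) auto
    qed
    moreover have "compact (C (Suc k) x)" "C (Suc k) x \<noteq> {}" if x: "x \<in> space N" for x
    proof -
      have "compact (C k x)" "C k x \<noteq> {}" using Suc x by auto
      note m = min[OF this, of "d k"]
      then obtain a where a: "a \<in> C k x" "\<forall>b\<in>C k x. ennreal (dist a (d k)) \<le> ennreal (dist b (d k))" by blast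
      then show "C (Suc k) x \<noteq> {}" by (auto simp: CSuc)
      have "C (Suc k) x = C k x \<inter> {b. ennreal (dist b (d k)) \<le> ennreal (dist a (d k))}"
        using a by (auto simp: CSuc intro: order.trans)
      then show "compact (C (Suc k) x)"
        using compact_Int_closed[OF \<open>compact (C k x)\<close> closed_sub] by (simp only:)
    qed
    ultimately show ?case by simp
  qed
  have dec: "C (Suc k) x \<subseteq> C k x" for k x by (auto simp: CSuc)
  \<comment> \<open>By compactness the intersection meets \<open>F\<close> once every
    \<open>C k x\<close> does. Hence membership of the limit point in \<open>F\<close> becomes a
    countable conjunction of hit conditions.\<close>
  have meet: "(\<Inter>k. C k x \<inter> F) \<noteq> {}" if "x \<in> space N" "closed F" "\<And>k. C k x \<inter> F \<noteq> {}" for x F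
  proof (rule compact_decseq_Int_nonempty)
    show "compact (C k x \<inter> F)" for k using C that by (intro compact_Int_closed) auto
    show "C (Suc k) x \<inter> F \<subseteq> C k x \<inter> F" for k using dec by blast
  qed (fact that)
  have unique: "a = b" if "a \<in> (\<Inter>k. C k x)" "b \<in> (\<Inter>k. C k x)" for a b x
  proof (rule ccontr)
    assume "a \<noteq> b"
    have eq: "dist a (d k) = dist b (d k)" for k
    proof -
      have ab: "a \<in> C j x" "b \<in> C j x" for j using that by auto
      have "ennreal (dist a (d k)) = ennreal (dist b (d k))"
        using ab(1)[of "Suc k"] ab(2)[of "Suc k"] ab[of k] unfolding CSuc mem_Collect_eq
        by (meson antisym)
      then show ?thesis by simp
    qed
    \<comment> \<open>A point of the dense sequence closer to \<open>a\<close> than half of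
      \<open>dist a b\<close> cannot be equally far from \<open>b\<close>.\<close>
    obtain k where "d k \<in> ball a (dist a b / 2)"
      using dense[of "ball a (dist a b / 2)"] \<open>a \<noteq> b\<close> by auto
    then have "dist a (d k) < dist a b / 2" by simp
    moreover have "dist a b \<le> dist a (d k) + dist b (d k)" by (rule dist_triangle2)
    ultimately show False using eq[of k] by simp
  qed
  define \<phi> where "\<phi> x = (SOME a. a \<in> (\<Inter>k. C k x))" for x
  have \<phi>: "\<phi> x \<in> (\<Inter>k. C k x)" if "x \<in> space N" for x
  proof -
    have "C k x \<inter> UNIV \<noteq> {}" for k using C[of k] that by simp
    then have "(\<Inter>k. C k x \<inter> UNIV) \<noteq> {}" using meet[OF that closed_UNIV] by simp
    then have "\<exists>a. a \<in> (\<Inter>k. C k x)" by auto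
    then show ?thesis unfolding \<phi>_def by (rule someI_ex)
  qed
  have "{x\<in>space N. \<phi> x \<in> F} \<in> sets N" if F: "closed F" for F
  proof -
    have "\<phi> x \<in> F \<longleftrightarrow> (\<forall>k. C k x \<inter> F \<noteq> {})" if x: "x \<in> space N" for x
    proof
      assume "\<forall>k. C k x \<inter> F \<noteq> {}"
      then have "(\<Inter>k. C k x \<inter> F) \<noteq> {}" by (intro meet[OF x F]) simp
      then obtain a where a: "a \<in> (\<Inter>k. C k x \<inter> F)" by blast
      then have "a \<in> (\<Inter>k. C k x)" "a \<in> F" by auto
      then show "\<phi> x \<in> F" using unique[OF \<phi>[OF x] \<open>a \<in> (\<Inter>k. C k x)\<close>] by simp
    next
      assume "\<phi> x \<in> F"
      moreover have "\<phi> x \<in> C k x" for k using \<phi>[OF x] by auto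
      ultimately have "\<phi> x \<in> C k x \<inter> F" for k by simp
      then show "\<forall>k. C k x \<inter> F \<noteq> {}" by (metis emptyE)
    qed
    then have "{x\<in>space N. \<phi> x \<in> F} = {x\<in>space N. \<forall>k. C k x \<inter> F \<noteq> {}}" by blast
    also have "\<dots> \<in> sets N"
      using C F by (intro sets.sets_Collect_countable_All) (simp add: hit_measurable_def)
    finally show ?thesis .
  qed
  then have "\<phi> \<in> borel_measurable N"
  proof (intro borel_measurableI)
    fix U :: "'a set" assume *: "\<And>F. closed F \<Longrightarrow> {x\<in>space N. \<phi> x \<in> F} \<in> sets N" and "open U"
    have "\<phi> -` U \<inter> space N = space N - {x\<in>space N. \<phi> x \<in> - U}" by blast
    then show "\<phi> -` U \<inter> space N \<in> sets N" using *[of "- U"] \<open>open U\<close> by auto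
  qed
  moreover have "\<phi> x \<in> B x" if "x \<in> space N" for x
  proof -
    have "\<phi> x \<in> C 0 x" using \<phi>[OF that] by (rule INT_D) simp
    then show ?thesis by (simp only: C0)
  qed
  ultimately show ?thesis by (intro bexI[of _ \<phi>] ballI)
qed

text \<open>The sets of minimizers are compact as sublevel sets at the minimum. Their hit conditions
  reduce to complements of relatively open subsets of \<open>X\<close>, so the selection theorem
  applies to them.\<close>

lemma measurable_minimizer:
  fixes A :: "'x::topological_space \<Rightarrow> 'a::polish_space set"
  assumes g: "lsc_on (Sigma X A) g" and K: "\<And>x. x \<in> X \<Longrightarrow> compact (A x)"
    and ne: "\<And>x. x \<in> X \<Longrightarrow> A x \<noteq> {}"
    and upper: "\<And>U. open U \<Longrightarrow> openin (top_of_set X) {x\<in>X. A x \<subseteq> U}"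
  shows "\<exists>\<phi>\<in>borel_measurable (restrict_space borel X). \<forall>x\<in>X. \<phi> x \<in> A x \<and> (\<forall>b\<in>A x. g (x, \<phi> x) \<le> g (x, b))"
proof -
  let ?N = "restrict_space borel X"
  have sp: "space ?N = X" by (simp add: space_restrict_space)
  have open_sets: "S \<in> sets ?N" if "openin (top_of_set X) S" for S
  proof -
    obtain T where "open T" "S = X \<inter> T" using \<open>openin (top_of_set X) S\<close> unfolding openin_open by blast
    then show ?thesis by (auto simp: sets_restrict_space)
  qed
  have min: "\<exists>a\<in>A x \<inter> F. \<forall>b\<in>A x \<inter> F. g (x, a) \<le> g (x, b)"
    if "x \<in> X" "closed F" "A x \<inter> F \<noteq> {}" for x F
  proof (rule lsc_on_attains_min)
    show "compact (A x \<inter> F)" using K that by (intro compact_Int_closed)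
    show "lsc_on (A x \<inter> F) (\<lambda>a. g (x, a))"
      unfolding lsc_on_def
    proof
      fix r
      have "openin (top_of_set (A x)) (A x \<inter> {a. r < g (x, a)})"
        using lsc_on_section[OF g \<open>x \<in> X\<close>] by (simp add: lsc_on_def Int_def)
      then have "openin (top_of_set (A x \<inter> F)) (A x \<inter> F \<inter> {a. r < g (x, a)})"
        by (rule openin_subtopology_Int_subset) simp
      then show "openin (top_of_set (A x \<inter> F)) {a \<in> A x \<inter> F. r < g (x, a)}"
        by (simp add: Int_def)
    qed
  qed (fact that)
  have "hit_measurable ?N (\<lambda>x. {a\<in>A x. \<forall>b\<in>A x. g (x, a) \<le> g (x, b)})"
  proof (rule hit_measurable_argmin)
    show "hit_measurable ?N A"
      unfolding hit_measurable_def sp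
    proof (intro allI impI)
      fix F :: "'a set" assume "closed F"
      then have "space ?N - {x\<in>X. A x \<subseteq> - F} \<in> sets ?N"
        by (intro sets.compl_sets open_sets upper) auto
      also have "space ?N - {x\<in>X. A x \<subseteq> - F} = {x\<in>X. A x \<inter> F \<noteq> {}}"
        unfolding sp by blast
      finally show "{x\<in>X. A x \<inter> F \<noteq> {}} \<in> sets ?N" .
    qed
    fix F :: "'a set" assume F: "closed F"
    show "{x\<in>space ?N. \<exists>a\<in>A x \<inter> F. g (x, a) \<le> r} \<in> sets ?N" for r
    proof -
      \<comment> \<open>The states whose actions in \<open>F\<close> all have value above
        \<open>r\<close> form an open set; those with an action in \<open>F\<close> of value at most
        \<open>r\<close> are its complement.\<close>
      have "space ?N - {x\<in>X. \<forall>a\<in>A x \<inter> F. r < g (x, a)} \<in> sets ?N"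
        by (intro sets.compl_sets open_sets openin_all_fibre_greater g K upper F)
      also have "space ?N - {x\<in>X. \<forall>a\<in>A x \<inter> F. r < g (x, a)} = {x\<in>space ?N. \<exists>a\<in>A x \<inter> F. g (x, a) \<le> r}"
        unfolding sp by (auto simp: not_le[symmetric])
      finally show ?thesis .
    qed
    show "\<exists>a\<in>A x \<inter> F. \<forall>b\<in>A x \<inter> F. g (x, a) \<le> g (x, b)" if "x \<in> space ?N" "A x \<inter> F \<noteq> {}" for x
      using min[OF _ F that(2)] that(1) by (simp only: sp)
  qed
  moreover have "compact {a\<in>A x. \<forall>b\<in>A x. g (x, a) \<le> g (x, b)}" if x: "x \<in> X" for x
  proof -
    obtain m where m: "m \<in> A x" "\<forall>b\<in>A x. g (x, m) \<le> g (x, b)"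
      using min[OF x, of UNIV] ne[OF x] by auto
    have "{a\<in>A x. \<forall>b\<in>A x. g (x, a) \<le> g (x, b)} = {a\<in>A x. g (x, a) \<le> g (x, m)}"
      using m by (auto intro: order.trans)
    then show ?thesis using lsc_on_compact_sublevel[OF K[OF x] lsc_on_section[OF g x]] by simp
  qed
  moreover have "{a\<in>A x. \<forall>b\<in>A x. g (x, a) \<le> g (x, b)} \<noteq> {}" if x: "x \<in> X" for x
    using min[OF x, of UNIV] ne[OF x] by auto
  ultimately have "\<exists>\<phi>\<in>borel_measurable ?N. \<forall>x\<in>space ?N. \<phi> x \<in> {a\<in>A x. \<forall>b\<in>A x. g (x, a) \<le> g (x, b)}"
    by (intro measurable_selection_compact) (auto simp only: sp)
  then show ?thesis by (simp add: sp)
qed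

section \<open>Expected costs along trajectories\<close>

text \<open>One policy and one initial state are fixed, and \<open>p\<close> is stochastic on all
  pairs. The locale is interpreted twice, with the normalized kernel and with the transformed
  kernel.\<close>

locale controlled_process =
  fixes MX :: "'x measure" and MA :: "'a measure" and A :: "'x \<Rightarrow> 'a set"
    and p :: "'x \<times> 'a \<Rightarrow> 'x measure" and \<pi> :: "('x, 'a) policy" and x0 :: 'x
  assumes kernel[measurable]: "p \<in> MX \<Otimes>\<^sub>M MA \<rightarrow>\<^sub>M prob_algebra MX"
    and feasible[measurable]: "Sigma (space MX) A \<in> sets (MX \<Otimes>\<^sub>M MA)"
    and policy: "\<pi> \<in> policies MX MA A"
    and initial[simp]: "x0 \<in> space MX"
begin

abbreviation "M \<equiv> MX \<Otimes>\<^sub>M MA"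
abbreviation "G \<equiv> Sigma (space MX) A"
abbreviation "hist n \<equiv> PiM {0..<n} (\<lambda>_. M)"
abbreviation "L \<equiv> trajectory_law MX MA p \<pi> x0"

definition state_law :: "nat \<Rightarrow> (nat \<Rightarrow> 'x \<times> 'a) \<Rightarrow> 'x measure" where
  "state_law n h = (if n = 0 then return MX x0 else p (h (n - 1)))"

lemma step_kernel_eq:
  "step_kernel MX MA p \<pi> x0 n h = state_law n h \<bind> (\<lambda>y. \<pi> n h y \<bind> (\<lambda>a. return M (y, a)))"
  by (simp add: step_kernel_def state_law_def)

lemma policy_measurable[measurable]: "(\<lambda>(h, y). \<pi> n h y) \<in> hist n \<Otimes>\<^sub>M MX \<rightarrow>\<^sub>M prob_algebra MA"
  using policy by (simp add: policies_def)

lemma policy_feasible: "h \<in> space (hist n) \<Longrightarrow> y \<in> space MX \<Longrightarrow> emeasure (\<pi> n h y) (A y) = 1"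
  using policy by (simp add: policies_def)

lemma space_policy:
  assumes "h \<in> space (hist n)" "y \<in> space MX"
  shows "\<pi> n h y \<in> space (prob_algebra MA)"
  using measurable_space[OF policy_measurable, of "(h, y)" n] assms by (simp add: space_pair_measure)

lemma state_law_measurable[measurable]: "state_law n \<in> hist n \<rightarrow>\<^sub>M prob_algebra MX"
proof (cases n)
  case 0
  then show ?thesis
    by (auto simp: state_law_def[abs_def] space_prob_algebra prob_space_return)
next
  case (Suc m)
  have [measurable]: "(\<lambda>h. h m) \<in> hist (Suc m) \<rightarrow>\<^sub>M M"
    by (rule measurable_component_singleton) simp
  show ?thesis using Suc by (simp add: state_law_def[abs_def])
qed

lemma action_measurable[measurable]:
  "(\<lambda>(h, y). \<pi> n h y \<bind> (\<lambda>a. return M (y, a))) \<in> hist n \<Otimes>\<^sub>M MX \<rightarrow>\<^sub>M prob_algebra M"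
proof -
  have [measurable]: "(\<lambda>z. \<pi> n (fst z) (snd z)) \<in> hist n \<Otimes>\<^sub>M MX \<rightarrow>\<^sub>M prob_algebra MA"
    using policy_measurable[of n] by (simp add: split_def)
  show ?thesis unfolding split_def by measurable
qed

lemma step_measurable[measurable]:
  "step_kernel MX MA p \<pi> x0 n \<in> hist n \<rightarrow>\<^sub>M prob_algebra M"
  unfolding step_kernel_eq[abs_def] by measurable

section \<open>Integration against the trajectory law\<close>

sublocale IT: Ionescu_Tulcea "step_kernel MX MA p \<pi> x0" "\<lambda>_. M"
proof (rule Ionescu_Tulcea.intro)
  fix i
  show m: "step_kernel MX MA p \<pi> x0 i \<in> hist i \<rightarrow>\<^sub>M subprob_algebra M"
    by (rule measurable_prob_algebraD[OF step_measurable])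
  fix h assume "h \<in> space (hist i)"
  then show "prob_space (step_kernel MX MA p \<pi> x0 i h)"
    using measurable_space[OF step_measurable] by (simp add: space_prob_algebra)
qed

lemma law_eq: "L = IT.PF.lim"
  by (simp add: trajectory_law_def)

lemma sets_law[measurable_cong]: "sets L = sets (PiM UNIV (\<lambda>_. M))"
  by (simp add: law_eq)

text \<open>The projective limit is accessible only through its marginals; the marginal on the first
  \<open>n\<close> coordinates is the composition of the first \<open>n\<close> step
  kernels.\<close>

lemma nn_integral_prefix:
  assumes [measurable]: "f \<in> borel_measurable (hist n)"
  shows "(\<integral>\<^sup>+\<omega>. f (restrict \<omega> {0..<n}) \<partial>L) = (\<integral>\<^sup>+h. f h \<partial>IT.C 0 n (\<lambda>_. undefined))"
proof -
  have "(\<integral>\<^sup>+\<omega>. f (restrict \<omega> {0..<n}) \<partial>L) = (\<integral>\<^sup>+h. f h \<partial>distr L (hist n) (\<lambda>\<omega>. restrict \<omega> {0..<n}))"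
    by (subst nn_integral_distr) (auto intro!: measurable_restrict measurable_component_singleton cong: measurable_cong_sets[OF sets_law refl])
  also have "distr L (hist n) (\<lambda>\<omega>. restrict \<omega> {0..<n}) = IT.CI {0..<n}"
    unfolding law_eq by (rule IT.distr_lim) simp
  also have "\<dots> = IT.C 0 n (\<lambda>_. undefined)"
  proof (rule measure_eqI)
    have u: "IT.up_to {0..<n} \<le> n" by (subst IT.up_to_iff) auto
    show "sets (IT.CI {0..<n}) = sets (IT.C 0 n (\<lambda>_. undefined))"
      by (subst IT.sets_C) (auto simp: IT.CI_def space_PiM)
    fix B assume "B \<in> sets (IT.CI {0..<n})"
    then have "B \<in> sets (hist n)" by (simp add: IT.CI_def)
    then show "emeasure (IT.CI {0..<n}) B = emeasure (IT.C 0 n (\<lambda>_. undefined)) B"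
      by (subst IT.emeasure_CI[of _ n]) (auto simp: prod_emb_id space_PiM dest: sets.sets_into_space)
  qed
  finally show ?thesis .
qed

lemma component_measurable[measurable]: "(\<lambda>\<omega>. \<omega> n) \<in> L \<rightarrow>\<^sub>M M"
  by (subst measurable_cong_sets[OF sets_law refl]) simp

lemma prefix_measurable[measurable]: "(\<lambda>\<omega>. restrict \<omega> {0..<n}) \<in> L \<rightarrow>\<^sub>M hist n"
  by (subst measurable_cong_sets[OF sets_law refl])
    (auto intro!: measurable_restrict)

lemma space_law: "\<omega> \<in> space L \<Longrightarrow> \<omega> n \<in> space M"
  by (rule measurable_space[OF component_measurable])

lemma prefix_space: "\<omega> \<in> space L \<Longrightarrow> restrict \<omega> {0..<n} \<in> space (hist n)"
  by (rule measurable_space[OF prefix_measurable])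

text \<open>The tower property for conditioning on the first \<open>n\<close> pairs: the prefix law
  for \<open>Suc n\<close> is the one for \<open>n\<close>, extended by one step kernel.\<close>

lemma nn_integral_next:
  assumes f[measurable]: "(\<lambda>(h, z). f h z) \<in> borel_measurable (hist n \<Otimes>\<^sub>M M)"
  shows "(\<integral>\<^sup>+\<omega>. f (restrict \<omega> {0..<n}) (\<omega> n) \<partial>L)
    = (\<integral>\<^sup>+\<omega>. (\<integral>\<^sup>+z. f (restrict \<omega> {0..<n}) z \<partial>step_kernel MX MA p \<pi> x0 n (restrict \<omega> {0..<n})) \<partial>L)"
proof -
  define g where "g h = f (restrict h {0..<n}) (h n)" for h
  have g[measurable]: "g \<in> borel_measurable (hist (Suc n))"
  proof -
    have [measurable]: "(\<lambda>h. restrict h {0..<n}) \<in> hist (Suc n) \<rightarrow>\<^sub>M hist n" "(\<lambda>h. h n) \<in> hist (Suc n) \<rightarrow>\<^sub>M M"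
      by (auto intro!: measurable_restrict_subset measurable_component_singleton)
    show ?thesis unfolding g_def[abs_def]
      by (rule measurable_compose[OF _ f, where f="\<lambda>h. (restrict h {0..<n}, h n)", simplified]) measurable
  qed
  have S: "(\<lambda>h. \<integral>\<^sup>+z. f h z \<partial>step_kernel MX MA p \<pi> x0 n h) \<in> borel_measurable (hist n)"
    by (rule nn_integral_measurable_subprob_algebra2[OF f])
      (rule measurable_prob_algebraD[OF step_measurable])
  have "(\<integral>\<^sup>+\<omega>. f (restrict \<omega> {0..<n}) (\<omega> n) \<partial>L) = (\<integral>\<^sup>+\<omega>. g (restrict \<omega> {0..<Suc n}) \<partial>L)"
    by (simp add: g_def restrict_restrict Int_absorb2 min_def)
  also have "\<dots> = (\<integral>\<^sup>+h. g h \<partial>(IT.C 0 n (\<lambda>_. undefined) \<bind> IT.eP n))"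
    by (subst nn_integral_prefix) auto
  also have "\<dots> = (\<integral>\<^sup>+h. (\<integral>\<^sup>+h'. g h' \<partial>IT.eP n h) \<partial>IT.C 0 n (\<lambda>_. undefined))"
    by (rule nn_integral_bind[of _ "hist (Suc n)"])
      (auto simp: measurable_cong_sets[OF IT.sets_C] space_PiM intro!: IT.measurable_eP[of n, simplified])
  also have "\<dots> = (\<integral>\<^sup>+h. (\<integral>\<^sup>+z. f h z \<partial>step_kernel MX MA p \<pi> x0 n h) \<partial>IT.C 0 n (\<lambda>_. undefined))"
  proof (rule nn_integral_cong)
    fix h assume "h \<in> space (IT.C 0 n (\<lambda>_. undefined))"
    then have h: "h \<in> space (hist n)" by (subst (asm) IT.space_C) (auto simp: space_PiM)
    \<comment> \<open>Histories are extensional on \<open>{0..<n}\<close>, so appending a pair at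
      index \<open>n\<close> and cutting back changes nothing.\<close>
    then have "restrict (h(n := z)) {0..<n} = h" for z
      by (auto simp: space_PiM PiE_iff extensional_def fun_eq_iff restrict_def)
    then show "(\<integral>\<^sup>+h'. g h' \<partial>IT.eP n h) = (\<integral>\<^sup>+z. f h z \<partial>step_kernel MX MA p \<pi> x0 n h)"
      by (subst IT.nn_integral_eP[OF h g]) (simp add: g_def)
  qed
  also have "\<dots> = (\<integral>\<^sup>+\<omega>. (\<integral>\<^sup>+z. f (restrict \<omega> {0..<n}) z \<partial>step_kernel MX MA p \<pi> x0 n (restrict \<omega> {0..<n})) \<partial>L)"
    by (rule nn_integral_prefix[OF S, symmetric])
  finally show ?thesis .
qed

lemma nn_integral_step:
  assumes h: "h \<in> space (hist n)" and g[measurable]: "g \<in> borel_measurable M"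
  shows "(\<integral>\<^sup>+z. g z \<partial>step_kernel MX MA p \<pi> x0 n h)
    = (\<integral>\<^sup>+y. (\<integral>\<^sup>+a. g (y, a) \<partial>\<pi> n h y) \<partial>state_law n h)"
proof -
  have s: "state_law n h \<in> space (prob_algebra MX)"
    by (rule measurable_space[OF state_law_measurable h])
  have m: "(\<lambda>y. \<pi> n h y \<bind> (\<lambda>a. return M (y, a))) \<in> MX \<rightarrow>\<^sub>M prob_algebra M"
    using measurable_compose[OF measurable_Pair1'[OF h] action_measurable] by simp
  have "(\<integral>\<^sup>+z. g z \<partial>step_kernel MX MA p \<pi> x0 n h)
      = (\<integral>\<^sup>+y. (\<integral>\<^sup>+z. g z \<partial>(\<pi> n h y \<bind> (\<lambda>a. return M (y, a)))) \<partial>state_law n h)"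
    unfolding step_kernel_eq
    using s m by (intro nn_integral_bind[of _ M])
      (auto simp: space_prob_algebra measurable_prob_algebraD cong: measurable_cong_sets)
  also have "\<dots> = (\<integral>\<^sup>+y. (\<integral>\<^sup>+a. g (y, a) \<partial>\<pi> n h y) \<partial>state_law n h)"
  proof (rule nn_integral_cong)
    fix y assume "y \<in> space (state_law n h)"
    then have y: "y \<in> space MX" using s by (auto simp: space_prob_algebra dest: sets_eq_imp_space_eq)
    have sp: "sets (\<pi> n h y) = sets MA" "space (\<pi> n h y) = space MA"
      using space_policy[OF h y] by (auto simp: space_prob_algebra dest: sets_eq_imp_space_eq)
    have "(\<lambda>a. return M (y, a)) \<in> MA \<rightarrow>\<^sub>M prob_algebra M"
      using y by measurable
    then have "(\<integral>\<^sup>+z. g z \<partial>(\<pi> n h y \<bind> (\<lambda>a. return M (y, a))))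
        = (\<integral>\<^sup>+a. (\<integral>\<^sup>+z. g z \<partial>return M (y, a)) \<partial>\<pi> n h y)"
      by (intro nn_integral_bind[of _ M])
        (auto simp: measurable_prob_algebraD sp cong: measurable_cong_sets)
    also have "\<dots> = (\<integral>\<^sup>+a. g (y, a) \<partial>\<pi> n h y)"
      using y by (intro nn_integral_cong nn_integral_return) (auto simp: sp space_pair_measure)
    finally show "(\<integral>\<^sup>+z. g z \<partial>(\<pi> n h y \<bind> (\<lambda>a. return M (y, a)))) = (\<integral>\<^sup>+a. g (y, a) \<partial>\<pi> n h y)" .
  qed
  finally show ?thesis .
qed

text \<open>At each time the probability of an infeasible pair is the average of the mass that the
  policy puts outside \<open>A y\<close>, which is 0. This permits costs, masses and kernels to take
  arbitrary values off the graph.\<close>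

lemma AE_feasible: "AE \<omega> in L. \<forall>n. \<omega> n \<in> G"
  unfolding AE_all_countable
proof
  fix n
  have "(\<integral>\<^sup>+\<omega>. indicator (space M - G) (\<omega> n) \<partial>L) =
     (\<integral>\<^sup>+\<omega>. (\<integral>\<^sup>+z. indicator (space M - G) z \<partial>step_kernel MX MA p \<pi> x0 n (restrict \<omega> {0..<n})) \<partial>L)"
    by (rule nn_integral_next) measurable
  also have "\<dots> = (\<integral>\<^sup>+\<omega>. 0 \<partial>L)"
  proof (rule nn_integral_cong)
    fix \<omega> assume w: "\<omega> \<in> space L"
    define h where "h = restrict \<omega> {0..<n}"
    have h: "h \<in> space (hist n)" unfolding h_def by (rule prefix_space[OF w])
    have s: "state_law n h \<in> space (prob_algebra MX)"
      by (rule measurable_space[OF state_law_measurable h])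
    have "(\<integral>\<^sup>+z. indicator (space M - G) z \<partial>step_kernel MX MA p \<pi> x0 n h)
      = (\<integral>\<^sup>+y. (\<integral>\<^sup>+a. indicator (space M - G) (y, a) \<partial>\<pi> n h y) \<partial>state_law n h)"
      by (rule nn_integral_step[OF h]) measurable
    also have "\<dots> = (\<integral>\<^sup>+y. 0 \<partial>state_law n h)"
    proof (rule nn_integral_cong)
      fix y assume "y \<in> space (state_law n h)"
      then have y: "y \<in> space MX" using s by (auto simp: space_prob_algebra dest: sets_eq_imp_space_eq)
      interpret prob_space "\<pi> n h y" using space_policy[OF h y] by (simp add: space_prob_algebra)
      have "prob (A y) = 1" using policy_feasible[OF h y] by (simp add: measure_def)
      \<comment> \<open>A set that is not measurable has \<open>emeasure\<close> 0, so the value 1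
        forces measurability.\<close>
      moreover have "A y \<in> events"
        using policy_feasible[OF h y] emeasure_notin_sets[of "A y" "\<pi> n h y"] by force
      ultimately have "AE a in \<pi> n h y. a \<in> A y"
        by (rule prob_eq_1[THEN iffD1, rotated])
      then have "(\<integral>\<^sup>+a. indicator (space M - G) (y, a) \<partial>\<pi> n h y) = (\<integral>\<^sup>+a. 0 \<partial>\<pi> n h y)"
        using y by (intro nn_integral_cong_AE) (auto simp: indicator_def)
      then show "(\<integral>\<^sup>+a. indicator (space M - G) (y, a) \<partial>\<pi> n h y) = 0" by simp
    qed
    finally show "(\<integral>\<^sup>+z. indicator (space M - G) z \<partial>step_kernel MX MA p \<pi> x0 n (restrict \<omega> {0..<n})) = 0"
      by (simp add: h_def)
  qed
  finally have "(\<integral>\<^sup>+\<omega>. indicator (space M - G) (\<omega> n) \<partial>L) = 0" by simp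
  then have "AE \<omega> in L. indicator (space M - G) (\<omega> n) = (0::ennreal)"
    by (subst (asm) nn_integral_0_iff_AE) measurable
  then show "AE \<omega> in L. \<omega> n \<in> G"
    using AE_space by eventually_elim (auto simp: indicator_def space_law split: if_splits)
qed

lemma prob_space_law: "prob_space L"
proof
  interpret C: prob_space "IT.C 0 0 (\<lambda>_. undefined)" by (rule IT.prob_space_C) (simp add: space_PiM)
  show "emeasure L (space L) = 1"
    using nn_integral_prefix[of "\<lambda>_. 1" 0] C.emeasure_space_1 by simp
qed

section \<open>Costs weighted by a product along the trajectory\<close>

definition weight :: "('x \<times> 'a \<Rightarrow> ennreal) \<Rightarrow> nat \<Rightarrow> (nat \<Rightarrow> 'x \<times> 'a) \<Rightarrow> ennreal" where
  "weight \<alpha> n \<omega> = (\<Prod>k<n. \<alpha> (\<omega> k))"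

text \<open>With \<open>kernel_mass q\<close> for \<alpha> this is the total cost, with the constant
  discount factor it is the discounted cost.\<close>

definition weighted_cost :: "('x \<times> 'a \<Rightarrow> ennreal) \<Rightarrow> ('x \<times> 'a \<Rightarrow> ennreal) \<Rightarrow> ennreal" where
  "weighted_cost \<alpha> f = (\<integral>\<^sup>+\<omega>. (\<Sum>n. weight \<alpha> n \<omega> * f (\<omega> n)) \<partial>L)"

lemma weight_measurable[measurable]:
  "\<alpha> \<in> borel_measurable M \<Longrightarrow> weight \<alpha> n \<in> borel_measurable L"
  unfolding weight_def[abs_def]
  by (intro borel_measurable_prod_ennreal measurable_compose[OF component_measurable])

lemma weight_restrict: "weight \<alpha> n (restrict \<omega> {0..<n}) = weight \<alpha> n \<omega>"
  by (simp add: weight_def)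

lemma weight_hist_measurable[measurable]:
  assumes [measurable]: "\<alpha> \<in> borel_measurable M"
  shows "weight \<alpha> n \<in> borel_measurable (hist n)"
proof -
  have [measurable]: "k < n \<Longrightarrow> (\<lambda>h. h k) \<in> hist n \<rightarrow>\<^sub>M M" for k
    by (rule measurable_component_singleton) simp
  show ?thesis unfolding weight_def[abs_def] by measurable
qed

lemma integral_kernel_measurable[measurable]:
  "u \<in> borel_measurable MX \<Longrightarrow> (\<lambda>z. \<integral>\<^sup>+y. u y \<partial>p z) \<in> borel_measurable M"
  by (rule measurable_compose[OF measurable_prob_algebraD[OF kernel] nn_integral_measurable_subprob_algebra])

lemma sets_step:
  assumes "h \<in> space (hist n)" shows "sets (step_kernel MX MA p \<pi> x0 n h) = sets M"
  using measurable_space[OF step_measurable assms] by (simp add: space_prob_algebra)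

text \<open>The weight at time \<open>n\<close> involves only the pairs before time \<open>n\<close>
  and is therefore a constant for the conditional integral.\<close>

lemma nn_integral_weight_next:
  assumes [measurable]: "\<alpha> \<in> borel_measurable M" "g \<in> borel_measurable M"
  shows "(\<integral>\<^sup>+\<omega>. weight \<alpha> n \<omega> * g (\<omega> n) \<partial>L) =
    (\<integral>\<^sup>+\<omega>. weight \<alpha> n \<omega> * (\<integral>\<^sup>+y. (\<integral>\<^sup>+a. g (y, a) \<partial>\<pi> n (restrict \<omega> {0..<n}) y)
        \<partial>state_law n (restrict \<omega> {0..<n})) \<partial>L)"
proof -
  have "(\<integral>\<^sup>+\<omega>. weight \<alpha> n \<omega> * g (\<omega> n) \<partial>L)
      = (\<integral>\<^sup>+\<omega>. weight \<alpha> n (restrict \<omega> {0..<n}) * g (\<omega> n) \<partial>L)"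
    by (simp add: weight_restrict)
  also have "\<dots> = (\<integral>\<^sup>+\<omega>. (\<integral>\<^sup>+z. weight \<alpha> n (restrict \<omega> {0..<n}) * g z
      \<partial>step_kernel MX MA p \<pi> x0 n (restrict \<omega> {0..<n})) \<partial>L)"
    by (rule nn_integral_next) measurable
  also have "\<dots> = (\<integral>\<^sup>+\<omega>. weight \<alpha> n \<omega> * (\<integral>\<^sup>+y. (\<integral>\<^sup>+a. g (y, a) \<partial>\<pi> n (restrict \<omega> {0..<n}) y)
        \<partial>state_law n (restrict \<omega> {0..<n})) \<partial>L)"
  proof (rule nn_integral_cong)
    fix \<omega> assume "\<omega> \<in> space L"
    note h = prefix_space[OF this, of n]
    show "(\<integral>\<^sup>+z. weight \<alpha> n (restrict \<omega> {0..<n}) * g z \<partial>step_kernel MX MA p \<pi> x0 n (restrict \<omega> {0..<n}))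
      = weight \<alpha> n \<omega> * (\<integral>\<^sup>+y. (\<integral>\<^sup>+a. g (y, a) \<partial>\<pi> n (restrict \<omega> {0..<n}) y) \<partial>state_law n (restrict \<omega> {0..<n}))"
      by (subst nn_integral_cmult) (simp_all add: nn_integral_step[OF h] weight_restrict assms sets_step[OF h] cong: measurable_cong_sets)
  qed
  finally show ?thesis .
qed

lemma space_state_law:
  assumes "h \<in> space (hist n)" shows "space (state_law n h) = space MX"
  using measurable_space[OF state_law_measurable assms]
  by (auto simp: space_prob_algebra dest: sets_eq_imp_space_eq)

lemma nn_integral_weight_state:
  assumes [measurable]: "\<alpha> \<in> borel_measurable M" "u \<in> borel_measurable MX"
  shows "(\<integral>\<^sup>+\<omega>. weight \<alpha> n \<omega> * u (fst (\<omega> n)) \<partial>L) =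
    (\<integral>\<^sup>+\<omega>. weight \<alpha> n \<omega> * (\<integral>\<^sup>+y. u y \<partial>state_law n (restrict \<omega> {0..<n})) \<partial>L)"
proof -
  have "(\<integral>\<^sup>+y. (\<integral>\<^sup>+a. u (fst (y, a)) \<partial>\<pi> n (restrict \<omega> {0..<n}) y) \<partial>state_law n (restrict \<omega> {0..<n}))
      = (\<integral>\<^sup>+y. u y \<partial>state_law n (restrict \<omega> {0..<n}))" if "\<omega> \<in> space L" for \<omega>
  proof (rule nn_integral_cong)
    note h = prefix_space[OF that, of n]
    fix y assume "y \<in> space (state_law n (restrict \<omega> {0..<n}))"
    then have y: "y \<in> space MX" by (simp add: space_state_law[OF h])
    interpret prob_space "\<pi> n (restrict \<omega> {0..<n}) y"
      using space_policy[OF h y] by (simp add: space_prob_algebra)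
    show "(\<integral>\<^sup>+a. u (fst (y, a)) \<partial>\<pi> n (restrict \<omega> {0..<n}) y) = u y"
      by (simp add: emeasure_space_1)
  qed
  then show ?thesis
    by (subst nn_integral_weight_next) (auto intro!: nn_integral_cong)
qed

lemma state_law_Suc: "state_law (Suc n) (restrict \<omega> {0..<Suc n}) = p (\<omega> n)"
  by (simp add: state_law_def)

text \<open>A step of time contributes \<alpha> and \<open>p\<close> only through their product. For
  the normalized kernel this product is integration against \<open>q\<close>, which is how the mass
  that was divided out returns.\<close>

lemma nn_integral_weight_Suc:
  assumes [measurable]: "\<alpha> \<in> borel_measurable M" "u \<in> borel_measurable MX"
  shows "(\<integral>\<^sup>+\<omega>. weight \<alpha> (Suc n) \<omega> * u (fst (\<omega> (Suc n))) \<partial>L) =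
    (\<integral>\<^sup>+\<omega>. weight \<alpha> n \<omega> * (\<alpha> (\<omega> n) * (\<integral>\<^sup>+y. u y \<partial>p (\<omega> n))) \<partial>L)"
  by (subst nn_integral_weight_state) (simp_all only: assms state_law_Suc, simp add: weight_def mult.assoc)

lemma nn_integral_initial:
  assumes [measurable]: "u \<in> borel_measurable MX"
  shows "(\<integral>\<^sup>+\<omega>. u (fst (\<omega> 0)) \<partial>L) = u x0"
  using nn_integral_weight_state[of "\<lambda>_. 1" u 0] prob_space.emeasure_space_1[OF prob_space_law]
  by (simp add: weight_def state_law_def nn_integral_return)

lemma weighted_cost_cong:
  assumes "\<And>z. z \<in> G \<Longrightarrow> \<alpha> z = \<alpha>' z" "\<And>z. z \<in> G \<Longrightarrow> f z = f' z"
  shows "weighted_cost \<alpha> f = weighted_cost \<alpha>' f'"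
  unfolding weighted_cost_def
  using AE_feasible
  by (intro nn_integral_cong_AE, eventually_elim) (simp add: weight_def assms)

text \<open>\<open>u n\<close> plays the role of the optimal cost with \<open>n\<close> stages to
  go. Since \<open>step\<close> holds for every feasible action, it can be integrated along any
  trajectory law; nonnegativity of the costs then bounds the finite sum by the full series.\<close>

lemma weighted_cost_lower_bound:
  assumes \<alpha>: "\<alpha> \<in> borel_measurable (restrict_space M G)" and f: "f \<in> borel_measurable (restrict_space M G)"
    and u[measurable]: "\<And>n. u n \<in> borel_measurable MX" and u0: "\<And>x. x \<in> space MX \<Longrightarrow> u 0 x = 0"
    and step: "\<And>n x a. x \<in> space MX \<Longrightarrow> a \<in> A x \<Longrightarrow>
      u (Suc n) x \<le> f (x, a) + \<alpha> (x, a) * (\<integral>\<^sup>+y. u n y \<partial>p (x, a))"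
  shows "u N x0 \<le> weighted_cost \<alpha> f"
proof -
  \<comment> \<open>Extension by zero off the graph gives functions measurable on the whole product;
    almost sure feasibility makes the change invisible.\<close>
  define \<alpha>' where "\<alpha>' z = \<alpha> z * indicator G z" for z
  define f' where "f' z = f z * indicator G z" for z
  have [measurable]: "\<alpha>' \<in> borel_measurable M" "f' \<in> borel_measurable M"
    using \<alpha> f unfolding \<alpha>'_def[abs_def] f'_def[abs_def]
    by (simp_all add: borel_measurable_restrict_space_iff_ennreal sets.Int_space_eq2)
  define S where "S n = (\<integral>\<^sup>+\<omega>. (\<Sum>k<n. weight \<alpha>' k \<omega> * f' (\<omega> k)) \<partial>L)" for n
  \<comment> \<open>The horizon shrinks as time advances: after \<open>n\<close> stages the
    remainder is \<open>u (N - n)\<close>, so at \<open>n = N\<close> it is \<open>u 0\<close>,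
    which vanishes.\<close>
  have "u N x0 \<le> S n + (\<integral>\<^sup>+\<omega>. weight \<alpha>' n \<omega> * u (N - n) (fst (\<omega> n)) \<partial>L)" if "n \<le> N" for n
    using that
  proof (induction n)
    case 0
    then show ?case by (simp add: S_def weight_def nn_integral_initial)
  next
    case (Suc n)
    have "(\<integral>\<^sup>+\<omega>. weight \<alpha>' n \<omega> * u (N - n) (fst (\<omega> n)) \<partial>L)
      \<le> (\<integral>\<^sup>+\<omega>. weight \<alpha>' n \<omega> * f' (\<omega> n) + weight \<alpha>' n \<omega> * (\<alpha>' (\<omega> n) * (\<integral>\<^sup>+y. u (N - Suc n) y \<partial>p (\<omega> n))) \<partial>L)"
    proof (rule nn_integral_mono_AE, use AE_feasible in eventually_elim)
      case (elim \<omega>)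
      then have g: "\<omega> n \<in> G" by auto
      have "N - n = Suc (N - Suc n)" using Suc.prems by auto
      then have "u (N - n) (fst (\<omega> n)) \<le> f' (\<omega> n) + \<alpha>' (\<omega> n) * (\<integral>\<^sup>+y. u (N - Suc n) y \<partial>p (\<omega> n))"
        using step[of "fst (\<omega> n)" "snd (\<omega> n)" "N - Suc n"] g
        by (auto simp: \<alpha>'_def f'_def)
      then show ?case
        by (simp add: distrib_left[symmetric] mult_left_mono)
    qed
    also have "\<dots> = (\<integral>\<^sup>+\<omega>. weight \<alpha>' n \<omega> * f' (\<omega> n) \<partial>L) +
        (\<integral>\<^sup>+\<omega>. weight \<alpha>' (Suc n) \<omega> * u (N - Suc n) (fst (\<omega> (Suc n))) \<partial>L)"
      by (simp add: nn_integral_add nn_integral_weight_Suc)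
    finally have "S n + (\<integral>\<^sup>+\<omega>. weight \<alpha>' n \<omega> * u (N - n) (fst (\<omega> n)) \<partial>L) \<le>
      S (Suc n) + (\<integral>\<^sup>+\<omega>. weight \<alpha>' (Suc n) \<omega> * u (N - Suc n) (fst (\<omega> (Suc n))) \<partial>L)"
      by (simp add: S_def nn_integral_add add.assoc add_left_mono)
    with Suc show ?case by (meson Suc_leD order.trans)
  qed
  from this[of N] have "u N x0 \<le> S N + (\<integral>\<^sup>+\<omega>. weight \<alpha>' N \<omega> * u 0 (fst (\<omega> N)) \<partial>L)" by simp
  also have "(\<integral>\<^sup>+\<omega>. weight \<alpha>' N \<omega> * u 0 (fst (\<omega> N)) \<partial>L) = (\<integral>\<^sup>+\<omega>. 0 \<partial>L)"
    using space_law by (intro nn_integral_cong) (auto simp: u0 space_pair_measure mem_Times_iff)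
  also have "S N + \<dots> \<le> weighted_cost \<alpha>' f'"
    unfolding S_def weighted_cost_def by (auto intro!: nn_integral_mono sum_le_suminf)
  also have "weighted_cost \<alpha>' f' = weighted_cost \<alpha> f"
    by (rule weighted_cost_cong) (auto simp: \<alpha>'_def f'_def)
  finally show ?thesis .
qed

text \<open>\<open>Q\<close> is an abstract operator because the two processes present it
  differently. It is tied to \<alpha> and \<open>p\<close> only on measurable functions;
  \<open>Q_cong\<close> says that it reads its argument only on the state space, so the zero
  extensions of cost and weight do not affect its iterates.\<close>

lemma weighted_cost_stationary:
  assumes \<alpha>: "\<alpha> \<in> borel_measurable (restrict_space M G)" and f: "f \<in> borel_measurable (restrict_space M G)"
    and \<phi>: "\<phi> \<in> selectors MX MA A" and stationary: "\<pi> = stationary MA \<phi>"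
    and Q: "\<And>u x. u \<in> borel_measurable MX \<Longrightarrow> x \<in> space MX \<Longrightarrow>
      Q u x = \<alpha> (x, \<phi> x) * (\<integral>\<^sup>+y. u y \<partial>p (x, \<phi> x))"
    and Q_cong: "\<And>u u' x. (\<And>y. y \<in> space MX \<Longrightarrow> u y = u' y) \<Longrightarrow> x \<in> space MX \<Longrightarrow> Q u x = Q u' x"
  shows "weighted_cost \<alpha> f = (\<Sum>n. (Q ^^ n) (\<lambda>x. f (x, \<phi> x)) x0)"
proof -
  define \<alpha>' where "\<alpha>' z = \<alpha> z * indicator G z" for z
  define f' where "f' z = f z * indicator G z" for z
  have [measurable]: "\<alpha>' \<in> borel_measurable M" "f' \<in> borel_measurable M"
    using \<alpha> f unfolding \<alpha>'_def[abs_def] f'_def[abs_def]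
    by (simp_all add: borel_measurable_restrict_space_iff_ennreal sets.Int_space_eq2)
  have [measurable]: "\<phi> \<in> MX \<rightarrow>\<^sub>M MA" and \<phi>A: "\<And>x. x \<in> space MX \<Longrightarrow> \<phi> x \<in> A x"
    using \<phi> by (auto simp: selectors_def)
  have pow_cong: "(Q ^^ n) u x = (Q ^^ n) u' x"
    if "\<And>y. y \<in> space MX \<Longrightarrow> u y = u' y" "x \<in> space MX" for n u u' x
    using that by (induction n arbitrary: x) (auto intro!: Q_cong)
  \<comment> \<open>Under the stationary policy the action is a function of the state, so inside the
    expectation each pair may be replaced by its projection to the graph of \<phi>.\<close>
  have act: "(\<integral>\<^sup>+\<omega>. weight \<alpha>' n \<omega> * g (\<omega> n) \<partial>L) = (\<integral>\<^sup>+\<omega>. weight \<alpha>' n \<omega> * g (fst (\<omega> n), \<phi> (fst (\<omega> n))) \<partial>L)"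
    if [measurable]: "g \<in> borel_measurable M" for n g
  proof -
    define g' where "g' z = g (fst z, \<phi> (fst z))" for z :: "'x \<times> 'a"
    have [measurable]: "g' \<in> borel_measurable M" unfolding g'_def[abs_def] by measurable
    have inner: "(\<integral>\<^sup>+a. g (y, a) \<partial>\<pi> n h y) = (\<integral>\<^sup>+a. g' (y, a) \<partial>\<pi> n h y)" if "y \<in> space MX" for h y
      unfolding stationary stationary_def g'_def using that
      by (simp add: nn_integral_return measurable_space[of \<phi> MX MA])
    have "(\<integral>\<^sup>+y. (\<integral>\<^sup>+a. g (y, a) \<partial>\<pi> n (restrict \<omega> {0..<n}) y) \<partial>state_law n (restrict \<omega> {0..<n})) =
        (\<integral>\<^sup>+y. (\<integral>\<^sup>+a. g' (y, a) \<partial>\<pi> n (restrict \<omega> {0..<n}) y) \<partial>state_law n (restrict \<omega> {0..<n}))"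
      if "\<omega> \<in> space L" for \<omega>
      by (rule nn_integral_cong) (simp add: space_state_law[OF prefix_space[OF that]] inner)
    then have "(\<integral>\<^sup>+\<omega>. weight \<alpha>' n \<omega> * g (\<omega> n) \<partial>L) = (\<integral>\<^sup>+\<omega>. weight \<alpha>' n \<omega> * g' (\<omega> n) \<partial>L)"
      by (simp add: nn_integral_weight_next cong: nn_integral_cong)
    then show ?thesis by (simp add: g'_def)
  qed
  have moment: "(\<integral>\<^sup>+\<omega>. weight \<alpha>' n \<omega> * g (\<omega> n) \<partial>L) = (Q ^^ n) (\<lambda>x. g (x, \<phi> x)) x0"
    if "g \<in> borel_measurable M" for n g
    using that
  proof (induction n arbitrary: g)
    case 0
    then have [measurable]: "g \<in> borel_measurable M" .
    show ?case using act[of g 0] nn_integral_initial[of "\<lambda>x. g (x, \<phi> x)"]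
      by (simp add: weight_def)
  next
    case (Suc n)
    then have [measurable]: "g \<in> borel_measurable M" by simp
    \<comment> \<open>Conditioning on time \<open>n\<close> moves one application of
      \<open>Q\<close> from the trajectory into the integrand. The induction therefore ranges over
      all \<open>g\<close>.\<close>
    define g' where "g' z = \<alpha>' z * (\<integral>\<^sup>+y. g (y, \<phi> y) \<partial>p z)" for z
    have [measurable]: "g' \<in> borel_measurable M" unfolding g'_def[abs_def] by measurable
    have "(\<integral>\<^sup>+\<omega>. weight \<alpha>' (Suc n) \<omega> * g (\<omega> (Suc n)) \<partial>L) = (\<integral>\<^sup>+\<omega>. weight \<alpha>' n \<omega> * g' (\<omega> n) \<partial>L)"
      unfolding g'_def by (subst act) (simp_all add: nn_integral_weight_Suc[of _ "\<lambda>y. g (y, \<phi> y)"])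
    also have "\<dots> = (Q ^^ n) (\<lambda>x. g' (x, \<phi> x)) x0"
      by (rule Suc.IH) measurable
    also have "\<dots> = (Q ^^ n) (Q (\<lambda>x. g (x, \<phi> x))) x0"
      by (rule pow_cong) (auto simp: g'_def Q \<phi>A \<alpha>'_def)
    finally show ?case by (simp add: funpow_swap1)
  qed
  have "weighted_cost \<alpha> f = weighted_cost \<alpha>' f'"
    by (rule weighted_cost_cong) (auto simp: \<alpha>'_def f'_def)
  also have "\<dots> = (\<Sum>n. (\<integral>\<^sup>+\<omega>. weight \<alpha>' n \<omega> * f' (\<omega> n) \<partial>L))"
    unfolding weighted_cost_def by (rule nn_integral_suminf) measurable
  also have "\<dots> = (\<Sum>n. (Q ^^ n) (\<lambda>x. f' (x, \<phi> x)) x0)"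
    by (simp add: moment)
  also have "\<dots> = (\<Sum>n. (Q ^^ n) (\<lambda>x. f (x, \<phi> x)) x0)"
    by (intro suminf_cong pow_cong) (auto simp: f'_def \<phi>A)
  finally show ?thesis .
qed

end

section \<open>Kernels that need not be stochastic\<close>

lemma adjoin_generator: "insert {None} ((`) Some ` sets M) \<subseteq> Pow (insert None (Some ` space M))"
  by (auto dest: sets.sets_into_space)

lemma space_adjoin_point[simp]: "space (adjoin_point M) = insert None (Some ` space M)"
  unfolding adjoin_point_def by (rule space_measure_of[OF adjoin_generator])

lemma sets_adjoin_point: "sets (adjoin_point M) =
    sigma_sets (insert None (Some ` space M)) (insert {None} ((`) Some ` sets M))"
  unfolding adjoin_point_def by (rule sets_measure_of[OF adjoin_generator])

lemma sets_adjoin_None[measurable]: "{None} \<in> sets (adjoin_point M)"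
  unfolding sets_adjoin_point by (rule sigma_sets.Basic) simp

lemma sets_adjoin_Some: "B \<in> sets M \<Longrightarrow> Some ` B \<in> sets (adjoin_point M)"
  unfolding sets_adjoin_point by (rule sigma_sets.Basic) simp

lemma measurable_Some_adjoin[measurable]: "Some \<in> M \<rightarrow>\<^sub>M adjoin_point M"
  unfolding adjoin_point_def
proof (rule measurable_measure_of[OF adjoin_generator])
  show "Some -` B \<inter> space M \<in> sets M" if "B \<in> insert {None} ((`) Some ` sets M)" for B
    using that by (auto simp: vimage_def image_def)
qed auto

lemma measurable_adjoin:
  assumes "f None \<in> space N" and f: "(\<lambda>x. f (Some x)) \<in> M \<rightarrow>\<^sub>M N"
  shows "f \<in> adjoin_point M \<rightarrow>\<^sub>M N"
proof (rule measurableI)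
  show "f s \<in> space N" if "s \<in> space (adjoin_point M)" for s
    using that assms(1) measurable_space[OF f] by auto
  fix C assume C: "C \<in> sets N"
  have "f -` C \<inter> space (adjoin_point M) =
    (if f None \<in> C then {None} else {}) \<union> Some ` ((\<lambda>x. f (Some x)) -` C \<inter> space M)"
    by auto
  also have "\<dots> \<in> sets (adjoin_point M)"
    by (intro sets.Un sets_adjoin_Some measurable_sets[OF f C]) (simp add: sets_adjoin_None)
  finally show "f -` C \<inter> space (adjoin_point M) \<in> sets (adjoin_point M)" .
qed

text \<open>The discount factor cancels against the factor in the denominator of the transformed
  kernel. The case split is needed because \<open>I\<close> may be infinite.\<close>

lemma ennreal_mult_divide_scale:
  assumes "0 < b" "0 < m" shows "ennreal b * (I / ennreal (b * m)) = I / ennreal m"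
  using assms
  by (cases I) (auto simp: divide_ennreal ennreal_mult[symmetric] ennreal_top_divide ennreal_mult_top ennreal_top_mult)

lemma ennreal_mult_divide_cancel:
  assumes "0 < m" shows "ennreal m * (I / ennreal m) = I"
  using assms
  by (cases I) (auto simp: divide_ennreal ennreal_mult[symmetric] ennreal_top_divide ennreal_mult_top)

lemma stationary_policy:
  assumes \<phi>: "\<phi> \<in> selectors MX MA A" and A: "Sigma (space MX) A \<in> sets (MX \<Otimes>\<^sub>M MA)"
  shows "stationary MA \<phi> \<in> policies MX MA A"
proof -
  have [measurable]: "\<phi> \<in> MX \<rightarrow>\<^sub>M MA" and sel: "\<And>x. x \<in> space MX \<Longrightarrow> \<phi> x \<in> A x"
    using \<phi> by (auto simp: selectors_def)
  have "A x \<in> sets MA" if "x \<in> space MX" for x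
    using sets_Pair1[OF A, of x] that by (simp add: vimage_def)
  then have "\<forall>x\<in>space MX. emeasure (return MA (\<phi> x)) (A x) = 1"
    by (simp add: sel)
  then show ?thesis
    by (simp add: policies_def stationary_def split_beta)
qed

section \<open>Decision models with finite transition measures\<close>

locale transition_model =
  fixes MX :: "'x measure" and MA :: "'a measure" and A :: "'x \<Rightarrow> 'a set"
    and c :: "'x \<times> 'a \<Rightarrow> real" and q :: "'x \<times> 'a \<Rightarrow> 'x measure"
  assumes feasible[measurable]: "Sigma (space MX) A \<in> sets (MX \<Otimes>\<^sub>M MA)"
    and cost_nonneg: "\<And>z. z \<in> Sigma (space MX) A \<Longrightarrow> 0 \<le> c z"
    and cost_measurable: "c \<in> borel_measurable (restrict_space (MX \<Otimes>\<^sub>M MA) (Sigma (space MX) A))"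
    and sets_kernel: "\<And>z. z \<in> Sigma (space MX) A \<Longrightarrow> sets (q z) = sets MX"
    and finite_kernel: "\<And>z. z \<in> Sigma (space MX) A \<Longrightarrow> finite_measure (q z)"
    and kernel_measurable: "\<And>B. B \<in> sets MX \<Longrightarrow>
      (\<lambda>z. emeasure (q z) B) \<in> borel_measurable (restrict_space (MX \<Otimes>\<^sub>M MA) (Sigma (space MX) A))"
begin

abbreviation "pairs \<equiv> MX \<Otimes>\<^sub>M MA"
abbreviation "graph \<equiv> Sigma (space MX) A"
abbreviation "on_G \<equiv> restrict_space pairs graph"

lemma space_on_G: "space on_G = graph"
  using sets.sets_into_space[OF feasible] by (auto simp: space_restrict_space)

lemma space_kernel: "z \<in> graph \<Longrightarrow> space (q z) = space MX"
  by (rule sets_eq_imp_space_eq[OF sets_kernel])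

lemma extend_measurable:
  assumes "f \<in> borel_measurable on_G" shows "(\<lambda>z. f z * indicator graph z :: ennreal) \<in> borel_measurable pairs"
  using assms feasible by (simp add: borel_measurable_restrict_space_iff_ennreal sets.Int_space_eq2)

lemma kernel_mass_measurable: "kernel_mass q \<in> borel_measurable on_G"
proof -
  have "kernel_mass q z = emeasure (q z) (space MX)" if "z \<in> graph" for z
    using space_kernel[OF that] by (simp add: kernel_mass_def)
  then have "kernel_mass q \<in> borel_measurable on_G \<longleftrightarrow> (\<lambda>z. emeasure (q z) (space MX)) \<in> borel_measurable on_G"
    by (intro measurable_cong) (simp add: space_on_G)
  then show ?thesis
    using kernel_measurable[OF sets.top] by simp
qed

text \<open>The measures \<open>q z\<close> are controlled only on the graph and their mass may
  exceed one, so measurability is obtained by induction over \<open>u\<close> on the restricted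
  space.\<close>

lemma nn_integral_kernel_measurable:
  assumes "u \<in> borel_measurable MX"
  shows "(\<lambda>z. \<integral>\<^sup>+y. u y \<partial>q z) \<in> borel_measurable on_G"
  using assms
proof induct
  case (cong f g)
  have "(\<lambda>z. \<integral>\<^sup>+y. f y \<partial>q z) \<in> borel_measurable on_G \<longleftrightarrow> (\<lambda>z. \<integral>\<^sup>+y. g y \<partial>q z) \<in> borel_measurable on_G"
    using cong(3) by (intro measurable_cong nn_integral_cong) (simp add: space_on_G space_kernel)
  with cong show ?case by simp
next
  case (set B)
  have "(\<lambda>z. \<integral>\<^sup>+y. indicator B y \<partial>q z) \<in> borel_measurable on_G \<longleftrightarrow> (\<lambda>z. emeasure (q z) B) \<in> borel_measurable on_G"
    using set by (intro measurable_cong nn_integral_indicator) (simp add: space_on_G sets_kernel)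
  with kernel_measurable[OF set] show ?case by simp
next
  case (mult f c)
  have "(\<lambda>z. \<integral>\<^sup>+y. c * f y \<partial>q z) \<in> borel_measurable on_G \<longleftrightarrow> (\<lambda>z. c * (\<integral>\<^sup>+y. f y \<partial>q z)) \<in> borel_measurable on_G"
    using mult by (intro measurable_cong nn_integral_cmult) (simp add: space_on_G measurable_cong_sets[OF sets_kernel refl])
  with mult show ?case by simp
next
  case (add f g)
  have "(\<lambda>z. \<integral>\<^sup>+y. g y + f y \<partial>q z) \<in> borel_measurable on_G \<longleftrightarrow>
      (\<lambda>z. (\<integral>\<^sup>+y. g y \<partial>q z) + (\<integral>\<^sup>+y. f y \<partial>q z)) \<in> borel_measurable on_G"
    using add by (intro measurable_cong nn_integral_add) (simp_all add: space_on_G measurable_cong_sets[OF sets_kernel refl])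
  with add show ?case by simp
next
  case (seq F)
  have "(\<lambda>z. \<integral>\<^sup>+y. (SUP i. F i) y \<partial>q z) \<in> borel_measurable on_G \<longleftrightarrow>
      (\<lambda>z. SUP i. (\<integral>\<^sup>+y. F i y \<partial>q z)) \<in> borel_measurable on_G"
    unfolding SUP_apply using seq
    by (intro measurable_cong nn_integral_monotone_convergence_SUP) (simp_all add: space_on_G measurable_cong_sets[OF sets_kernel refl])
  with seq show ?case by simp
qed

lemma normalized_kernel_measurable:
  assumes p0: "prob_space p0" "sets p0 = sets MX"
  shows "normalized_kernel graph p0 q \<in> pairs \<rightarrow>\<^sub>M prob_algebra MX"
proof -
  let ?p = "normalized_kernel graph p0 q"
  have mass: "kernel_mass q z < \<infinity>" if "z \<in> graph" for z
  proof -
    interpret finite_measure "q z" by (rule finite_kernel[OF that])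
    show ?thesis by (simp add: kernel_mass_def less_top[symmetric])
  qed
  have sets: "sets (?p z) = sets MX" for z
    by (simp add: normalized_kernel_def p0 sets_kernel)
  have prob: "prob_space (?p z)" for z
  proof (cases "z \<in> graph \<and> kernel_mass q z \<noteq> 0")
    case True
    then show ?thesis
      using mass[of z]
      by (intro prob_spaceI) (simp add: normalized_kernel_def kernel_mass_def space_scale_measure ennreal_divide_self[unfolded divide_ennreal_def] mult.commute)
  next
    case False
    then have "?p z = p0" by (auto simp: normalized_kernel_def)
    then show ?thesis by (simp add: p0)
  qed
  show ?thesis
  proof (intro measurable_prob_algebraI measurable_subprob_algebra prob sets prob_space_imp_subprob_space)
    fix B assume B: "B \<in> sets MX"
    define m where "m z = kernel_mass q z * indicator graph z" for z
    define e where "e z = emeasure (q z) B * indicator graph z" for z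
    have [measurable]: "m \<in> borel_measurable pairs" "e \<in> borel_measurable pairs"
      using extend_measurable[OF kernel_mass_measurable] extend_measurable[OF kernel_measurable[OF B]]
      by (simp_all add: m_def[abs_def] e_def[abs_def])
    have "emeasure (?p z) B = (if z \<in> graph \<and> m z \<noteq> 0 then inverse (m z) * e z else emeasure p0 B)" for z
      by (simp add: normalized_kernel_def m_def e_def)
    then show "(\<lambda>z. emeasure (?p z) B) \<in> borel_measurable pairs"
      by simp
  qed
qed

text \<open>At positive mass the two scalings cancel because the mass is finite. At mass zero both
  sides vanish, so the substitute \<open>p0\<close> has no influence.\<close>

lemma nn_integral_normalized_kernel:
  assumes z: "z \<in> graph" and u: "u \<in> borel_measurable MX"
  shows "kernel_mass q z * (\<integral>\<^sup>+y. u y \<partial>normalized_kernel graph p0 q z) = (\<integral>\<^sup>+y. u y \<partial>q z)"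
proof (cases "kernel_mass q z = 0")
  case True
  then have "AE y in q z. u y = 0"
    by (intro AE_I[of _ _ "space (q z)"]) (auto simp: kernel_mass_def)
  then have "(\<integral>\<^sup>+y. u y \<partial>q z) = (\<integral>\<^sup>+y. 0 \<partial>q z)" by (rule nn_integral_cong_AE)
  with True show ?thesis by simp
next
  case False
  interpret finite_measure "q z" by (rule finite_kernel[OF z])
  have "kernel_mass q z \<noteq> top" by (simp add: kernel_mass_def)
  have "kernel_mass q z * (\<integral>\<^sup>+y. u y \<partial>normalized_kernel graph p0 q z)
    = (kernel_mass q z * inverse (kernel_mass q z)) * (\<integral>\<^sup>+y. u y \<partial>q z)"
    using False z u
    by (simp add: normalized_kernel_def nn_integral_scale_measure measurable_cong_sets[OF sets_kernel refl] mult.assoc)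
  also have "kernel_mass q z * inverse (kernel_mass q z) = 1"
    using False \<open>kernel_mass q z \<noteq> top\<close> by (simp add: ennreal_divide_self[unfolded divide_ennreal_def] less_top)
  finally show ?thesis by simp
qed

lemma controlled_process_normalized:
  assumes "prob_space p0" "sets p0 = sets MX" "\<pi> \<in> policies MX MA A" "x \<in> space MX"
  shows "controlled_process MX MA A (normalized_kernel graph p0 q) \<pi> x"
  using assms by unfold_locales (auto intro: normalized_kernel_measurable feasible)

lemma ennreal_cost_measurable: "(\<lambda>z. ennreal (c z)) \<in> borel_measurable on_G"
  by (rule measurable_compose[OF cost_measurable measurable_ennreal])

lemma selector_measurable:
  assumes \<phi>: "\<phi> \<in> selectors MX MA A" and f: "f \<in> borel_measurable on_G"
  shows "(\<lambda>x. f (x, \<phi> x) :: ennreal) \<in> borel_measurable MX"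
proof -
  have [measurable]: "\<phi> \<in> MX \<rightarrow>\<^sub>M MA" using \<phi> by (simp add: selectors_def)
  have "(\<lambda>x. f (x, \<phi> x) * indicator graph (x, \<phi> x)) \<in> borel_measurable MX"
    by (rule measurable_compose[OF _ extend_measurable[OF f]]) measurable
  moreover have "f (x, \<phi> x) = f (x, \<phi> x) * indicator graph (x, \<phi> x)" if "x \<in> space MX" for x
    using that \<phi> by (simp add: selectors_def)
  ultimately show ?thesis by (subst measurable_cong) auto
qed

lemma stage_cost_measurable:
  "\<phi> \<in> selectors MX MA A \<Longrightarrow> (\<lambda>x. ennreal (c (x, \<phi> x))) \<in> borel_measurable MX"
  by (rule selector_measurable[OF _ ennreal_cost_measurable])

lemma kernel_op_measurable:
  "\<phi> \<in> selectors MX MA A \<Longrightarrow> u \<in> borel_measurable MX \<Longrightarrow> kernel_op q \<phi> u \<in> borel_measurable MX"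
  unfolding kernel_op_def by (rule selector_measurable[OF _ nn_integral_kernel_measurable])

lemma kernel_op_iterate_measurable:
  "\<phi> \<in> selectors MX MA A \<Longrightarrow> u \<in> borel_measurable MX \<Longrightarrow> (kernel_op q \<phi> ^^ n) u \<in> borel_measurable MX"
  by (induction n) (simp_all add: kernel_op_measurable)

section \<open>Bounds for the total cost of the original process\<close>

lemma total_cost_lower_bound:
  assumes p0: "prob_space p0" "sets p0 = sets MX" and "\<pi> \<in> policies MX MA A" "x \<in> space MX"
    and u: "\<And>n. u n \<in> borel_measurable MX" "\<And>x. x \<in> space MX \<Longrightarrow> u 0 x = 0"
    and step: "\<And>n x a. x \<in> space MX \<Longrightarrow> a \<in> A x \<Longrightarrow>
      u (Suc n) x \<le> ennreal (c (x, a)) + (\<integral>\<^sup>+y. u n y \<partial>q (x, a))"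
  shows "u N x \<le> total_cost MX MA A c q p0 \<pi> x"
proof -
  interpret controlled_process MX MA A "normalized_kernel graph p0 q" \<pi> x
    by (rule controlled_process_normalized) fact+
  have "u N x \<le> weighted_cost (kernel_mass q) (\<lambda>z. ennreal (c z))"
    using u step by (intro weighted_cost_lower_bound kernel_mass_measurable ennreal_cost_measurable)
      (auto simp: nn_integral_normalized_kernel)
  then show ?thesis by (simp add: total_cost_def weighted_cost_def weight_def)
qed

lemma total_cost_stationary:
  assumes p0: "prob_space p0" "sets p0 = sets MX" and \<phi>: "\<phi> \<in> selectors MX MA A" and x: "x \<in> space MX"
  shows "total_cost MX MA A c q p0 (stationary MA \<phi>) x =
    (\<Sum>n. (kernel_op q \<phi> ^^ n) (\<lambda>x. ennreal (c (x, \<phi> x))) x)"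
proof -
  interpret controlled_process MX MA A "normalized_kernel graph p0 q" "stationary MA \<phi>" x
    by (rule controlled_process_normalized[OF p0 stationary_policy[OF \<phi> feasible] x])
  have "weighted_cost (kernel_mass q) (\<lambda>z. ennreal (c z)) =
      (\<Sum>n. (kernel_op q \<phi> ^^ n) (\<lambda>x. ennreal (c (x, \<phi> x))) x)"
  proof (rule weighted_cost_stationary[OF kernel_mass_measurable ennreal_cost_measurable \<phi> refl])
    show "kernel_op q \<phi> u x = kernel_mass q (x, \<phi> x) * (\<integral>\<^sup>+y. u y \<partial>normalized_kernel graph p0 q (x, \<phi> x))"
      if "u \<in> borel_measurable MX" "x \<in> space MX" for u x
      using that \<phi> by (simp add: kernel_op_def nn_integral_normalized_kernel selectors_def)
    show "kernel_op q \<phi> u x = kernel_op q \<phi> u' x"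
      if "\<And>y. y \<in> space MX \<Longrightarrow> u y = u' y" "x \<in> space MX" for u u' x
      using that \<phi> unfolding kernel_op_def
      by (intro nn_integral_cong) (simp add: space_kernel selectors_def)
  qed
  then show ?thesis by (simp add: total_cost_def weighted_cost_def weight_def)
qed

lemma stationary_cost_fixpoint:
  assumes p0: "prob_space p0" "sets p0 = sets MX" and \<phi>: "\<phi> \<in> selectors MX MA A" and x: "x \<in> space MX"
  shows "total_cost MX MA A c q p0 (stationary MA \<phi>) x = ennreal (c (x, \<phi> x)) +
    (\<integral>\<^sup>+y. total_cost MX MA A c q p0 (stationary MA \<phi>) y \<partial>q (x, \<phi> x))"
proof -
  define f where "f n = (kernel_op q \<phi> ^^ n) (\<lambda>x. ennreal (c (x, \<phi> x)))" for n
  have f: "f n \<in> borel_measurable MX" for n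
    unfolding f_def by (rule kernel_op_iterate_measurable[OF \<phi> stage_cost_measurable[OF \<phi>]])
  have z: "(x, \<phi> x) \<in> graph" using \<phi> x by (simp add: selectors_def)
  have "(\<Sum>n. f n x) = f 0 x + (\<Sum>n. f (Suc n) x)"
    by (subst suminf_offset[of _ 1]) (simp_all add: add.commute)
  also have "(\<Sum>n. f (Suc n) x) = (\<Sum>n. \<integral>\<^sup>+y. f n y \<partial>q (x, \<phi> x))"
    by (simp add: f_def kernel_op_def)
  also have "\<dots> = (\<integral>\<^sup>+y. (\<Sum>n. f n y) \<partial>q (x, \<phi> x))"
    using f by (intro nn_integral_suminf[symmetric]) (simp add: measurable_cong_sets[OF sets_kernel[OF z] refl])
  also have "\<dots> = (\<integral>\<^sup>+y. total_cost MX MA A c q p0 (stationary MA \<phi>) y \<partial>q (x, \<phi> x))"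
    by (intro nn_integral_cong) (simp add: space_kernel[OF z] total_cost_stationary[OF p0 \<phi>] f_def)
  finally show ?thesis by (simp add: total_cost_stationary[OF p0 \<phi> x] f_def)
qed

text \<open>A supersolution dominates every partial sum of the cost series: the first
  \<open>Suc n\<close> terms at \<open>x\<close> are the stage cost plus the integral of the first
  \<open>n\<close> terms. The induction starts from nonnegativity of \<open>w\<close>, which is
  built into \<open>ennreal\<close>.\<close>

lemma stationary_cost_upper_bound:
  assumes p0: "prob_space p0" "sets p0 = sets MX" and \<phi>: "\<phi> \<in> selectors MX MA A" and x: "x \<in> space MX"
    and w: "\<And>x. x \<in> space MX \<Longrightarrow> ennreal (c (x, \<phi> x)) + (\<integral>\<^sup>+y. w y \<partial>q (x, \<phi> x)) \<le> w x"
  shows "total_cost MX MA A c q p0 (stationary MA \<phi>) x \<le> w x"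
proof -
  define f where "f n = (kernel_op q \<phi> ^^ n) (\<lambda>x. ennreal (c (x, \<phi> x)))" for n
  have f: "f n \<in> borel_measurable MX" for n
    unfolding f_def by (rule kernel_op_iterate_measurable[OF \<phi> stage_cost_measurable[OF \<phi>]])
  have "(\<Sum>k<n. f k x) \<le> w x" for n
    using x
  proof (induction n arbitrary: x)
    case (Suc n)
    then have z: "(x, \<phi> x) \<in> graph" using \<phi> by (simp add: selectors_def)
    have "(\<Sum>k<Suc n. f k x) = f 0 x + (\<Sum>k<n. \<integral>\<^sup>+y. f k y \<partial>q (x, \<phi> x))"
      unfolding sum.lessThan_Suc_shift by (simp add: f_def kernel_op_def)
    also have "\<dots> = f 0 x + (\<integral>\<^sup>+y. (\<Sum>k<n. f k y) \<partial>q (x, \<phi> x))"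
      using f by (subst nn_integral_sum) (simp_all add: measurable_cong_sets[OF sets_kernel[OF z] refl])
    also have "\<dots> \<le> ennreal (c (x, \<phi> x)) + (\<integral>\<^sup>+y. w y \<partial>q (x, \<phi> x))"
      using Suc.IH by (intro add_mono nn_integral_mono) (simp_all add: space_kernel[OF z] f_def)
    also have "\<dots> \<le> w x" by (rule w[OF Suc.prems])
    finally show ?case .
  qed simp
  then have "(\<Sum>n. f n x) \<le> w x" by (intro suminf_le_const) auto
  then show ?thesis by (simp add: total_cost_stationary[OF p0 \<phi> x] f_def)
qed

end

section \<open>The transformed process\<close>

text \<open>\<open>contraction\<close> says that the transformed masses are at most one.
  \<open>nonempty\<close> provides a feasible pair that serves as a filler value. The type variable
  \<open>'a\<close> stands for states here and \<open>'b\<close> for actions.\<close>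

locale hv_model = transition_model +
  fixes \<mu> :: "'a \<Rightarrow> real" and \<beta> :: real
  assumes weight_measurable[measurable]: "\<mu> \<in> borel_measurable MX"
    and weight_pos: "\<And>x. x \<in> space MX \<Longrightarrow> 0 < \<mu> x"
    and discount_pos: "0 < \<beta>"
    and contraction: "\<And>x a. x \<in> space MX \<Longrightarrow> a \<in> A x \<Longrightarrow> (\<integral>\<^sup>+y. ennreal (\<mu> y) \<partial>q (x, a)) \<le> ennreal (\<beta> * \<mu> x)"
    and nonempty: "Sigma (space MX) A \<noteq> {}"
begin

abbreviation "HX \<equiv> adjoin_point MX"
abbreviation "HA \<equiv> adjoin_point MA"
abbreviation "hpairs \<equiv> HX \<Otimes>\<^sub>M HA"
abbreviation "hgraph \<equiv> Sigma (space HX) (hv_actions A)"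
abbreviation "hker \<equiv> hv_kernel MX A q \<mu> \<beta>"
abbreviation "hcost \<equiv> hv_cost \<mu> c"

definition mass_on :: "'a option set \<Rightarrow> 'a \<times> 'b \<Rightarrow> ennreal" where
  "mass_on B z = (\<integral>\<^sup>+y. ennreal (\<mu> y) * indicator B (Some y) \<partial>q z)"

lemma mass_on_measurable:
  assumes [measurable]: "B \<in> sets HX" shows "mass_on B \<in> borel_measurable on_G"
  unfolding mass_on_def[abs_def] by (rule nn_integral_kernel_measurable) measurable

lemma mass_on_space: "(x, a) \<in> graph \<Longrightarrow> mass_on (space HX) (x, a) = (\<integral>\<^sup>+y. ennreal (\<mu> y) \<partial>q (x, a))"
  unfolding mass_on_def by (rule nn_integral_cong) (simp add: space_kernel)

lemma mass_fraction_le_1: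
  assumes "(x, a) \<in> graph"
  shows "(\<integral>\<^sup>+y. ennreal (\<mu> y) \<partial>q (x, a)) / ennreal (\<beta> * \<mu> x) \<le> 1"
proof -
  have "0 < \<beta> * \<mu> x" using assms weight_pos discount_pos by auto
  then have "(\<integral>\<^sup>+y. ennreal (\<mu> y) \<partial>q (x, a)) / ennreal (\<beta> * \<mu> x) \<le> ennreal (\<beta> * \<mu> x) / ennreal (\<beta> * \<mu> x)"
    using assms contraction by (intro divide_right_mono_ennreal) auto
  also have "\<dots> = 1" using \<open>0 < \<beta> * \<mu> x\<close> by (intro ennreal_divide_self) auto
  finally show ?thesis .
qed

text \<open>The part of the transformed transition that stays among the original states. As a
  push-forward of a density it is a measure by construction, and integrals against it reduce to
  integrals against \<open>q\<close>.\<close>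

definition moved :: "'a \<Rightarrow> 'b \<Rightarrow> 'a option measure" where
  "moved x a = distr (density (q (x, a)) (\<lambda>y. ennreal (\<mu> y) / ennreal (\<beta> * \<mu> x))) HX Some"

lemma nn_integral_moved:
  assumes z: "(x, a) \<in> graph" and [measurable]: "u \<in> borel_measurable HX"
  shows "(\<integral>\<^sup>+s. u s \<partial>moved x a) = (\<integral>\<^sup>+y. ennreal (\<mu> y) * u (Some y) \<partial>q (x, a)) / ennreal (\<beta> * \<mu> x)"
proof -
  have [measurable]: "\<mu> \<in> borel_measurable (q (x, a))" "Some \<in> q (x, a) \<rightarrow>\<^sub>M HX"
    "(\<lambda>y. u (Some y)) \<in> borel_measurable (q (x, a))"
    by (simp_all add: measurable_cong_sets[OF sets_kernel[OF z] refl])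
  have "(\<integral>\<^sup>+s. u s \<partial>moved x a) = (\<integral>\<^sup>+y. ennreal (\<mu> y) / ennreal (\<beta> * \<mu> x) * u (Some y) \<partial>q (x, a))"
    unfolding moved_def by (simp add: nn_integral_distr nn_integral_density)
  also have "\<dots> = (\<integral>\<^sup>+y. (ennreal (\<mu> y) * u (Some y)) / ennreal (\<beta> * \<mu> x) \<partial>q (x, a))"
    by (simp add: divide_ennreal_def mult_ac)
  also have "\<dots> = (\<integral>\<^sup>+y. ennreal (\<mu> y) * u (Some y) \<partial>q (x, a)) / ennreal (\<beta> * \<mu> x)"
    by (rule nn_integral_divide) measurable
  finally show ?thesis .
qed

lemma sets_hker: "sets (hker z) = sets HX"
  unfolding hv_kernel_def
  by (cases z) (simp only: prod.case sets.sets_measure_of_eq sets_return split: option.split if_split, simp)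

text \<open>\<open>measure_of\<close> takes the prescribed values only once countable additivity is
  known. It is inherited from a sum of two measures, \<open>moved x a\<close> and a multiple
  \<open>k\<close> of the point mass at \<open>None\<close>.\<close>

lemma emeasure_hker:
  assumes z: "(x, a) \<in> graph" and B: "B \<in> sets HX"
  shows "emeasure (hker (Some x, Some a)) B = mass_on B (x, a) / ennreal (\<beta> * \<mu> x)
    + (1 - (\<integral>\<^sup>+y. ennreal (\<mu> y) \<partial>q (x, a)) / ennreal (\<beta> * \<mu> x)) * indicator B None"
proof -
  define k where "k = 1 - (\<integral>\<^sup>+y. ennreal (\<mu> y) \<partial>q (x, a)) / ennreal (\<beta> * \<mu> x)"
  define F where "F B = (\<integral>\<^sup>+y. ennreal (\<mu> y) * indicator (Some -` B) y \<partial>q (x, a)) / ennreal (\<beta> * \<mu> x)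
      + k * indicator B None" for B
  have F: "F B = emeasure (moved x a) B + k * emeasure (return HX None) B" if [measurable]: "B \<in> sets HX" for B
  proof -
    have "emeasure (moved x a) B = (\<integral>\<^sup>+s. indicator B s \<partial>moved x a)"
      using that by (intro nn_integral_indicator[symmetric]) (simp add: moved_def)
    also have "\<dots> = (\<integral>\<^sup>+y. ennreal (\<mu> y) * indicator B (Some y) \<partial>q (x, a)) / ennreal (\<beta> * \<mu> x)"
      using that by (intro nn_integral_moved z) measurable
    finally show ?thesis using that by (simp add: F_def indicator_vimage)
  qed
  have "emeasure (hker (Some x, Some a)) B = F B"
  proof (rule emeasure_measure_of)
    show "hker (Some x, Some a) = measure_of (space HX) (sets HX) F"
      using z by (simp add: hv_kernel_def F_def[abs_def] k_def)
    show "sets HX \<subseteq> Pow (space HX)" by (rule sets.space_closed)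
    show "positive (sets (hker (Some x, Some a))) F" by (simp add: positive_def F_def)
    show "countably_additive (sets (hker (Some x, Some a))) F"
    proof (rule countably_additiveI)
      fix D :: "nat \<Rightarrow> 'a option set"
      assume D: "range D \<subseteq> sets (hker (Some x, Some a))" "disjoint_family D"
      then have D': "range D \<subseteq> sets HX" "\<And>i. D i \<in> sets HX" "(\<Union>i. D i) \<in> sets HX"
        by (auto simp: sets_hker)
      have "(\<Sum>i. F (D i)) = (\<Sum>i. emeasure (moved x a) (D i)) + k * (\<Sum>i. emeasure (return HX None) (D i))"
        using D' by (simp add: F suminf_add[symmetric] ennreal_suminf_cmult)
      also have "\<dots> = F (\<Union>i. D i)"
        unfolding F[OF D'(3)] using D'(1) D(2)
        by (subst (1 2) suminf_emeasure) (auto simp: moved_def simp del: space_adjoin_point)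
      finally show "(\<Sum>i. F (D i)) = F (\<Union>i. D i)" .
    qed
    show "B \<in> sets (hker (Some x, Some a))" using B by (simp add: sets_hker)
  qed
  then show ?thesis by (simp add: F_def k_def mass_on_def indicator_vimage)
qed

lemma emeasure_hker_else:
  assumes "\<And>x a. z = (Some x, Some a) \<Longrightarrow> (x, a) \<notin> graph" "B \<in> sets HX"
  shows "emeasure (hker z) B = indicator B None"
  using assms by (cases z) (auto simp: hv_kernel_def split: option.split)

text \<open>Restricted to the original states the kernel is \<open>moved x a\<close>, and the
  escaping mass is multiplied by \<open>u None\<close>, which is 0. For this reason all comparison
  functions are extended by 0 to the added point.\<close>

lemma nn_integral_hker:
  assumes z: "(x, a) \<in> graph" and u[measurable]: "u \<in> borel_measurable HX" and "u None = 0"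
  shows "(\<integral>\<^sup>+s. u s \<partial>hker (Some x, Some a)) =
    (\<integral>\<^sup>+y. ennreal (\<mu> y) * u (Some y) \<partial>q (x, a)) / ennreal (\<beta> * \<mu> x)"
proof -
  have S: "Some ` space MX \<in> sets HX" by (rule sets_adjoin_Some) simp
  have "density (hker (Some x, Some a)) (indicator (Some ` space MX)) = moved x a"
  proof (rule measure_eqI)
    show "sets (density (hker (Some x, Some a)) (indicator (Some ` space MX))) = sets (moved x a)"
      by (simp add: sets_hker moved_def)
    fix B assume "B \<in> sets (density (hker (Some x, Some a)) (indicator (Some ` space MX)))"
    then have B: "B \<in> sets HX" by (simp add: sets_hker)
    have "emeasure (density (hker (Some x, Some a)) (indicator (Some ` space MX))) B
        = emeasure (hker (Some x, Some a)) (Some ` space MX \<inter> B)"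
      using B S by (subst emeasure_density) (simp_all add: sets_hker indicator_inter_arith[symmetric] measurable_cong_sets[OF sets_hker refl])
    also have "\<dots> = mass_on (Some ` space MX \<inter> B) (x, a) / ennreal (\<beta> * \<mu> x)"
      using B S by (subst emeasure_hker[OF z]) auto
    also have "mass_on (Some ` space MX \<inter> B) (x, a) = mass_on B (x, a)"
      unfolding mass_on_def using space_kernel[OF z]
      by (intro nn_integral_cong) (auto simp: indicator_def)
    also have "mass_on B (x, a) / ennreal (\<beta> * \<mu> x) = (\<integral>\<^sup>+s. indicator B s \<partial>moved x a)"
      using B by (subst nn_integral_moved[OF z]) (auto simp: mass_on_def)
    also have "\<dots> = emeasure (moved x a) B"
      using B by (intro nn_integral_indicator) (simp add: moved_def)
    finally show "emeasure (density (hker (Some x, Some a)) (indicator (Some ` space MX))) B = emeasure (moved x a) B" .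
  qed
  moreover have "(\<integral>\<^sup>+s. u s \<partial>hker (Some x, Some a)) =
      (\<integral>\<^sup>+s. indicator (Some ` space MX) s * u s \<partial>hker (Some x, Some a))"
  proof (rule nn_integral_cong)
    fix s assume "s \<in> space (hker (Some x, Some a))"
    then have "s \<in> space HX" using sets_eq_imp_space_eq[OF sets_hker] by blast
    then show "u s = indicator (Some ` space MX) s * u s"
      using \<open>u None = 0\<close> by auto
  qed
  moreover have "\<dots> = (\<integral>\<^sup>+s. u s \<partial>density (hker (Some x, Some a)) (indicator (Some ` space MX)))"
    using S u by (intro nn_integral_density[symmetric])
      (simp_all add: measurable_cong_sets[OF sets_hker refl])
  ultimately show ?thesis using nn_integral_moved[OF z u] by simp
qed

text \<open>It fills in the values of \<open>strip\<close> at the added points, so that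
  measurability on the original pairs can be pulled back to all of \<open>hpairs\<close>. The test
  \<open>proper\<close> masks these values wherever \<open>strip\<close> is used.\<close>

definition default :: "'a \<times> 'b" where "default = (SOME z. z \<in> graph)"

lemma default: "fst default \<in> space MX" "snd default \<in> space MA"
proof -
  have "default \<in> graph" unfolding default_def using nonempty by (simp only: some_in_eq not_False_eq_True)
  then have "default \<in> space pairs" by (rule subsetD[OF sets.sets_into_space[OF feasible]])
  then show "fst default \<in> space MX" "snd default \<in> space MA"
    by (auto simp: space_pair_measure)
qed

definition strip :: "'a option \<times> 'b option \<Rightarrow> 'a \<times> 'b" where
  "strip z = (case_option (fst default) (\<lambda>x. x) (fst z), case_option (snd default) (\<lambda>a. a) (snd z))"

lemma strip_Some[simp]: "strip (Some x, Some a) = (x, a)"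
  by (simp add: strip_def)

lemma strip_measurable[measurable]: "strip \<in> hpairs \<rightarrow>\<^sub>M pairs"
proof -
  have [measurable]: "case_option (fst default) (\<lambda>x. x) \<in> HX \<rightarrow>\<^sub>M MX"
    by (rule measurable_adjoin) (simp_all add: default)
  have [measurable]: "case_option (snd default) (\<lambda>x. x) \<in> HA \<rightarrow>\<^sub>M MA"
    by (rule measurable_adjoin) (simp_all add: default)
  show ?thesis unfolding strip_def[abs_def] by measurable
qed

definition proper :: "'a option \<times> 'b option \<Rightarrow> bool" where
  "proper z \<longleftrightarrow> fst z \<noteq> None \<and> snd z \<noteq> None \<and> strip z \<in> graph"

lemma proper_Some[simp]: "proper (Some x, Some a) \<longleftrightarrow> (x, a) \<in> graph"
  by (simp add: proper_def)

lemma properE: "proper z \<Longrightarrow> (\<And>x a. z = (Some x, Some a) \<Longrightarrow> (x, a) \<in> graph \<Longrightarrow> P) \<Longrightarrow> P"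
  by (cases z) (auto simp: proper_def)

lemma is_None_measurable[measurable]: "Measurable.pred (adjoin_point N) (\<lambda>s. s = None)"
proof -
  have "{s \<in> space (adjoin_point N). s = None} = {None}" by auto
  then show ?thesis unfolding pred_def by (simp only: sets_adjoin_None)
qed

lemma proper_measurable[measurable]: "Measurable.pred hpairs proper"
  unfolding proper_def[abs_def] by measurable

lemma hgraph_sets: "hgraph \<in> sets hpairs"
proof -
  have "a \<in> space MA" if "x \<in> space MX" "a \<in> A x" for x a
    using subsetD[OF sets.sets_into_space[OF feasible], of "(x, a)"] that by (simp add: space_pair_measure)
  then have "hgraph = {z \<in> space hpairs. proper z \<or> fst z = None \<and> snd z = None}"
    by (auto simp: hv_actions_def space_pair_measure split: option.splits elim!: properE)
  also have "\<dots> \<in> sets hpairs" by measurable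
  finally show ?thesis .
qed

lemma hgraph_cases:
  assumes "z \<in> hgraph"
  obtains "z = (None, None)" | x a where "z = (Some x, Some a)" "(x, a) \<in> graph"
  using assms by (auto simp: hv_actions_def split: option.splits)

lemma hker_measurable: "hker \<in> hpairs \<rightarrow>\<^sub>M prob_algebra HX"
proof -
  \<comment> \<open>One formula on the whole product, composed of \<open>strip\<close> and of
    functions extended by zero off the graph; each ingredient is measurable there.\<close>
  have eq: "emeasure (hker z) B = (if proper z then
      mass_on B (strip z) * indicator graph (strip z) / ennreal (\<beta> * \<mu> (fst (strip z)))
      + (1 - mass_on (space HX) (strip z) * indicator graph (strip z) / ennreal (\<beta> * \<mu> (fst (strip z)))) * indicator B None
    else indicator B None)" if "B \<in> sets HX" for z B
  proof (cases "proper z")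
    case True
    then show ?thesis using that
      by (elim properE) (simp add: emeasure_hker mass_on_space[symmetric] del: space_adjoin_point)
  next
    case False
    then show ?thesis using that by (subst emeasure_hker_else) auto
  qed
  have prob: "prob_space (hker z)" for z
  proof
    have sp: "space (hker z) = space HX" by (rule sets_eq_imp_space_eq[OF sets_hker])
    show "emeasure (hker z) (space (hker z)) = 1"
    proof (cases "proper z")
      case True
      then obtain x a where z: "z = (Some x, Some a)" "(x, a) \<in> graph" by (rule properE)
      show ?thesis
        unfolding sp unfolding z(1) using mass_fraction_le_1[OF z(2)]
        by (simp add: emeasure_hker[OF z(2) sets.top] mass_on_space[OF z(2)] add_diff_inverse_ennreal del: space_adjoin_point) simp
    next
      case False
      then have "emeasure (hker z) (space HX) = indicator (space HX) None"
        by (intro emeasure_hker_else sets.top) auto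
      then show ?thesis unfolding sp by simp
    qed
  qed
  have emeasure_measurable: "(\<lambda>z. emeasure (hker z) B) \<in> borel_measurable hpairs"
    if B: "B \<in> sets HX" for B
  proof -
    have [measurable]: "(\<lambda>z. mass_on B z * indicator graph z) \<in> borel_measurable pairs"
      "(\<lambda>z. mass_on (space HX) z * indicator graph z) \<in> borel_measurable pairs"
      using B by (auto intro!: extend_measurable mass_on_measurable simp del: space_adjoin_point)
    show ?thesis
      unfolding eq[OF B] by measurable
  qed
  show ?thesis
    by (intro measurable_prob_algebraI measurable_subprob_algebra prob_space_imp_subprob_space
        prob sets_hker emeasure_measurable)
qed

lemma hcost_measurable: "(\<lambda>z. ennreal (hcost z)) \<in> borel_measurable (restrict_space hpairs hgraph)"
proof -
  define f where "f z = (if proper z then ennreal (c (strip z)) * indicator graph (strip z) / ennreal (\<mu> (fst (strip z))) else 0)" for z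
  have [measurable]: "(\<lambda>z. ennreal (c z) * indicator graph z) \<in> borel_measurable pairs"
    by (intro extend_measurable ennreal_cost_measurable)
  have "f \<in> borel_measurable hpairs" unfolding f_def[abs_def] by measurable
  then have "f \<in> borel_measurable (restrict_space hpairs hgraph)" by (rule measurable_restrict_space1)
  moreover have "ennreal (hcost z) = f z" if "z \<in> hgraph" for z
    using that
  proof (cases rule: hgraph_cases)
    case 1 then show ?thesis by (simp add: hv_cost_def f_def proper_def)
  next
    case (2 x a)
    then show ?thesis using weight_pos[of x] cost_nonneg[of "(x, a)"]
      by (simp add: hv_cost_def f_def divide_ennreal)
  qed
  ultimately show ?thesis
    by (subst measurable_cong[where g=f]) (auto simp: space_restrict_space)
qed

section \<open>Comparison of the costs of the two processes\<close>

lemma map_option_selector: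
  assumes "\<phi> \<in> selectors MX MA A" shows "map_option \<phi> \<in> selectors HX HA (hv_actions A)"
proof -
  have [measurable]: "\<phi> \<in> MX \<rightarrow>\<^sub>M MA" and sel: "\<And>x. x \<in> space MX \<Longrightarrow> \<phi> x \<in> A x"
    using assms by (auto simp: selectors_def)
  have "map_option \<phi> \<in> HX \<rightarrow>\<^sub>M HA"
    by (rule measurable_adjoin) simp_all
  with sel show ?thesis by (auto simp: selectors_def hv_actions_def)
qed

lemma controlled_process_hv:
  assumes "\<pi> \<in> policies HX HA (hv_actions A)" "s \<in> space HX"
  shows "controlled_process HX HA (hv_actions A) hker \<pi> s"
  using assms by unfold_locales (auto intro: hker_measurable hgraph_sets simp del: space_adjoin_point)

text \<open>The density \<mu> in the kernel cancels the division of \<open>u n\<close> by \<mu>, the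
  discount factor cancels its reciprocal in the kernel, and what remains is \<open>step\<close>
  divided by \<open>\<mu> x\<close>, with stage cost \<open>c / \<mu>\<close>. At the added point
  both sides are 0.\<close>

lemma discounted_cost_lower_bound:
  assumes \<pi>: "\<pi> \<in> policies HX HA (hv_actions A)" and s: "s \<in> space HX"
    and u[measurable]: "\<And>n. u n \<in> borel_measurable MX" and u0: "\<And>x. x \<in> space MX \<Longrightarrow> u 0 x = 0"
    and step: "\<And>n x a. x \<in> space MX \<Longrightarrow> a \<in> A x \<Longrightarrow>
      u (Suc n) x \<le> ennreal (c (x, a)) + (\<integral>\<^sup>+y. u n y \<partial>q (x, a))"
  shows "case_option 0 (\<lambda>x. u N x / ennreal (\<mu> x)) s \<le> discounted_cost HX HA hcost hker \<beta> \<pi> s"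
proof -
  interpret controlled_process HX HA "hv_actions A" hker \<pi> s
    by (rule controlled_process_hv) fact+
  define w where "w n = case_option 0 (\<lambda>x. u n x / ennreal (\<mu> x))" for n
  have w[measurable]: "w n \<in> borel_measurable HX" for n
    unfolding w_def by (rule measurable_adjoin) simp_all
  have "w N s \<le> weighted_cost (\<lambda>_. ennreal \<beta>) (\<lambda>z. ennreal (hcost z))"
  proof (rule weighted_cost_lower_bound[OF _ hcost_measurable w])
    show "w 0 s = 0" if "s \<in> space HX" for s
      using that u0 by (auto simp: w_def)
    fix n s b assume "s \<in> space HX" "b \<in> hv_actions A s"
    then have "(s, b) \<in> hgraph" by blast
    then show "w (Suc n) s \<le> ennreal (hcost (s, b)) + ennreal \<beta> * (\<integral>\<^sup>+y. w n y \<partial>hker (s, b))"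
    proof (cases rule: hgraph_cases)
      case 1 then show ?thesis by (simp add: w_def)
    next
      case (2 x a)
      then have x: "x \<in> space MX" "a \<in> A x" "0 < \<mu> x" using weight_pos by auto
      have "(\<integral>\<^sup>+y. ennreal (\<mu> y) * w n (Some y) \<partial>q (x, a)) = (\<integral>\<^sup>+y. u n y \<partial>q (x, a))"
        using space_kernel[OF 2(2)] weight_pos
        by (intro nn_integral_cong) (simp add: w_def ennreal_mult_divide_cancel)
      then have "(\<integral>\<^sup>+y. w n y \<partial>hker (Some x, Some a)) = (\<integral>\<^sup>+y. u n y \<partial>q (x, a)) / ennreal (\<beta> * \<mu> x)"
        using nn_integral_hker[OF 2(2) w] by (simp add: w_def)
      moreover have "u (Suc n) x / ennreal (\<mu> x) \<le>
          ennreal (c (x, a)) / ennreal (\<mu> x) + (\<integral>\<^sup>+y. u n y \<partial>q (x, a)) / ennreal (\<mu> x)"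
        using divide_right_mono_ennreal[OF step[OF x(1,2)]] by (simp add: add_divide_distrib_ennreal)
      ultimately show ?thesis
        using 2 x cost_nonneg[OF 2(2)]
        by (simp add: w_def hv_cost_def divide_ennreal ennreal_mult_divide_scale[OF discount_pos])
    qed
  qed simp
  then show ?thesis
    using discount_pos
    by (simp add: w_def discounted_cost_def weighted_cost_def weight_def prod_constant ennreal_power)
qed

text \<open>On the original states the discounted transformed operator is
  \<open>kernel_op q \<phi>\<close> conjugated by multiplication with \<mu>. Conjugation passes to
  all powers, so the two cost series agree term by term up to the factor
  \<open>\<mu> x\<close>.\<close>

lemma discounted_cost_stationary:
  assumes \<phi>: "\<phi> \<in> selectors MX MA A" and s: "s \<in> space HX"
  shows "discounted_cost HX HA hcost hker \<beta> (stationary HA (map_option \<phi>)) s =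
    case_option 0 (\<lambda>x. (\<Sum>n. (kernel_op q \<phi> ^^ n) (\<lambda>x. ennreal (c (x, \<phi> x))) x) / ennreal (\<mu> x)) s"
proof -
  have [measurable]: "\<phi> \<in> MX \<rightarrow>\<^sub>M MA" and sel: "\<And>x. x \<in> space MX \<Longrightarrow> \<phi> x \<in> A x"
    using \<phi> by (auto simp: selectors_def)
  note \<phi>' = map_option_selector[OF \<phi>]
  interpret controlled_process HX HA "hv_actions A" hker "stationary HA (map_option \<phi>)" s
    by (rule controlled_process_hv[OF stationary_policy[OF \<phi>' hgraph_sets] s])
  define Q where "Q u s = ennreal \<beta> * (\<integral>\<^sup>+y. u y \<partial>hker (s, map_option \<phi> s))" for u s
  define f where "f = (\<lambda>x. ennreal (c (x, \<phi> x)))"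
  have iter: "(kernel_op q \<phi> ^^ n) f \<in> borel_measurable MX" for n
    unfolding f_def by (rule kernel_op_iterate_measurable[OF \<phi> stage_cost_measurable[OF \<phi>]])
  have Q_cong: "Q u s = Q u' s" if "\<And>y. y \<in> space HX \<Longrightarrow> u y = u' y" for u u' s
    unfolding Q_def using that sets_eq_imp_space_eq[OF sets_hker]
    by (intro arg_cong2[where f="(*)"] refl nn_integral_cong) auto
  have pow: "(Q ^^ n) (\<lambda>s. ennreal (hcost (s, map_option \<phi> s))) s =
      case_option 0 (\<lambda>x. (kernel_op q \<phi> ^^ n) f x / ennreal (\<mu> x)) s" if "s \<in> space HX" for n s
    using that
  proof (induction n arbitrary: s)
    case 0
    then show ?case
      using weight_pos cost_nonneg sel by (auto simp: hv_cost_def f_def divide_ennreal)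
  next
    case (Suc n)
    define w where "w = case_option 0 (\<lambda>x. (kernel_op q \<phi> ^^ n) f x / ennreal (\<mu> x))"
    have w: "w \<in> borel_measurable HX"
      unfolding w_def using iter[of n] by (intro measurable_adjoin) simp_all
    have "(Q ^^ Suc n) (\<lambda>s. ennreal (hcost (s, map_option \<phi> s))) s = Q w s"
      using Suc.IH by (simp add: w_def) (rule Q_cong, simp)
    also have "\<dots> = case_option 0 (\<lambda>x. (kernel_op q \<phi> ^^ Suc n) f x / ennreal (\<mu> x)) s"
    proof (cases s)
      case None
      have "(\<integral>\<^sup>+y. w y \<partial>hker (None, None)) = w None"
        using w by (simp add: hv_kernel_def nn_integral_return)
      then show ?thesis using None by (simp add: Q_def w_def)
    next
      case (Some x)
      then have x: "x \<in> space MX" "(x, \<phi> x) \<in> graph" "0 < \<mu> x" using Suc.prems sel weight_pos by auto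
      have "(\<integral>\<^sup>+y. ennreal (\<mu> y) * w (Some y) \<partial>q (x, \<phi> x)) = (\<integral>\<^sup>+y. (kernel_op q \<phi> ^^ n) f y \<partial>q (x, \<phi> x))"
        using space_kernel[OF x(2)] weight_pos
        by (intro nn_integral_cong) (simp add: w_def ennreal_mult_divide_cancel)
      then have "(\<integral>\<^sup>+y. w y \<partial>hker (Some x, Some (\<phi> x))) = (\<integral>\<^sup>+y. (kernel_op q \<phi> ^^ n) f y \<partial>q (x, \<phi> x)) / ennreal (\<beta> * \<mu> x)"
        using nn_integral_hker[OF x(2) w] by (simp add: w_def)
      then show ?thesis
        using Some x by (simp add: Q_def kernel_op_def ennreal_mult_divide_scale[OF discount_pos])
    qed
    finally show ?case .
  qed
  have "weighted_cost (\<lambda>_. ennreal \<beta>) (\<lambda>z. ennreal (hcost z)) =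
      (\<Sum>n. (Q ^^ n) (\<lambda>s. ennreal (hcost (s, map_option \<phi> s))) s)"
    by (rule weighted_cost_stationary[OF _ hcost_measurable \<phi>' refl]) (simp, simp only: Q_def, rule Q_cong)
  also have "\<dots> = (\<Sum>n. case_option 0 (\<lambda>x. (kernel_op q \<phi> ^^ n) f x / ennreal (\<mu> x)) s)"
    by (simp add: pow[OF s])
  also have "\<dots> = case_option 0 (\<lambda>x. (\<Sum>n. (kernel_op q \<phi> ^^ n) f x) / ennreal (\<mu> x)) s"
    by (simp split: option.split)
  finally show ?thesis
    using discount_pos unfolding f_def
    by (simp add: discounted_cost_def weighted_cost_def weight_def prod_constant ennreal_power)
qed

end

section \<open>Value iteration\<close>

lemma lower_semicontinuous_on_lsc:
  assumes "lower_semicontinuous_on S f" shows "lsc_on S (\<lambda>z. ennreal (f z))"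
  unfolding lsc_on_def
proof
  fix r
  show "openin (top_of_set S) {z\<in>S. r < ennreal (f z)}"
  proof (subst openin_subopen, intro ballI)
    fix z assume z: "z \<in> {z\<in>S. r < ennreal (f z)}"
    define r' where "r' = enn2real r"
    have r: "r = ennreal r'"
      unfolding r'_def using z by (auto intro!: ennreal_enn2real[symmetric] elim: order.strict_trans)
    have "0 \<le> r'" by (simp add: r'_def)
    then have "r' < f z" using z by (simp add: r ennreal_less_iff)
    then have "eventually (\<lambda>w. r' < f w) (at z within S)"
      using assms z by (simp add: lower_semicontinuous_on_def)
    then obtain T where T: "open T" "z \<in> T" "\<And>w. w \<in> T \<Longrightarrow> w \<noteq> z \<Longrightarrow> w \<in> S \<Longrightarrow> r' < f w"
      unfolding eventually_at_topological by blast
    have "S \<inter> T \<subseteq> {z\<in>S. r < ennreal (f z)}"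
    proof
      \<comment> \<open>The filter \<open>at z within S\<close> excludes \<open>z\<close> itself, so
        the centre is treated separately.\<close>
      fix w assume w: "w \<in> S \<inter> T"
      then have "r' < f w" using T(3)[of w] \<open>r' < f z\<close> by (cases "w = z") auto
      then show "w \<in> {z\<in>S. r < ennreal (f z)}"
        using w \<open>0 \<le> r'\<close> by (simp add: r ennreal_less_iff)
    qed
    moreover have "openin (top_of_set S) (S \<inter> T)" using T(1) by (rule openin_open_Int)
    ultimately show "\<exists>U. openin (top_of_set S) U \<and> z \<in> U \<and> U \<subseteq> {z\<in>S. r < ennreal (f z)}"
      using z T(2) by blast
  qed
qed

lemma continuous_set_valued_upper:
  assumes "continuous_set_valued S T \<Phi>" "\<And>s. s \<in> S \<Longrightarrow> \<Phi> s \<subseteq> T" "open U"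
  shows "openin (top_of_set S) {s\<in>S. \<Phi> s \<subseteq> U}"
proof -
  have "openin (top_of_set S) {s\<in>S. \<Phi> s \<subseteq> T \<inter> U}"
    using assms(1) openin_open_Int[OF assms(3), of T] unfolding continuous_set_valued_def by blast
  also have "{s\<in>S. \<Phi> s \<subseteq> T \<inter> U} = {s\<in>S. \<Phi> s \<subseteq> U}"
    using assms(2) by blast
  finally show ?thesis .
qed

text \<open>By second countability the Borel sets of the product space come from the product
  algebra. This transports Borel assumptions about the graph to
  \<open>MX \<Otimes>\<^sub>M MA\<close>.\<close>

lemma measurable_pair_restrict_borel:
  fixes X :: "'x::second_countable_topology set" and Y :: "'y::second_countable_topology set"
  shows "(\<lambda>z. z) \<in> restrict_space borel X \<Otimes>\<^sub>M restrict_space borel Y \<rightarrow>\<^sub>M borel"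
proof -
  have "fst \<in> restrict_space borel X \<Otimes>\<^sub>M restrict_space borel Y \<rightarrow>\<^sub>M borel"
    by (rule measurable_compose[OF measurable_fst]) (rule measurable_restrict_space1, simp)
  moreover have "snd \<in> restrict_space borel X \<Otimes>\<^sub>M restrict_space borel Y \<rightarrow>\<^sub>M borel"
    by (rule measurable_compose[OF measurable_snd]) (rule measurable_restrict_space1, simp)
  ultimately have "(\<lambda>z. (fst z, snd z)) \<in> restrict_space borel X \<Otimes>\<^sub>M restrict_space borel Y \<rightarrow>\<^sub>M borel \<Otimes>\<^sub>M borel"
    by (rule measurable_Pair)
  then show ?thesis by (simp add: borel_prod)
qed

context transition_model
begin

primrec finite_horizon_value :: "nat \<Rightarrow> 'x \<Rightarrow> ennreal" where
  "finite_horizon_value 0 = (\<lambda>x. 0)"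
| "finite_horizon_value (Suc n) =
    (\<lambda>x. INF a\<in>A x. ennreal (c (x, a)) + (\<integral>\<^sup>+y. finite_horizon_value n y \<partial>q (x, a)))"

definition infinite_horizon_value :: "'x \<Rightarrow> ennreal" where
  "infinite_horizon_value x = (SUP n. finite_horizon_value n x)"

lemma finite_horizon_value_step:
  "a \<in> A x \<Longrightarrow> finite_horizon_value (Suc n) x \<le> ennreal (c (x, a)) + (\<integral>\<^sup>+y. finite_horizon_value n y \<partial>q (x, a))"
  by (auto intro: INF_lower)

lemma finite_horizon_value_mono:
  "x \<in> space MX \<Longrightarrow> finite_horizon_value n x \<le> finite_horizon_value (Suc n) x"
proof (induction n arbitrary: x)
  case (Suc n)
  have "finite_horizon_value (Suc n) x \<le> ennreal (c (x, a)) + (\<integral>\<^sup>+y. finite_horizon_value (Suc n) y \<partial>q (x, a))"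
    if a: "a \<in> A x" for a
  proof -
    have "space (q (x, a)) = space MX" using a Suc.prems by (intro space_kernel) simp
    then have "(\<integral>\<^sup>+y. finite_horizon_value n y \<partial>q (x, a)) \<le> (\<integral>\<^sup>+y. finite_horizon_value (Suc n) y \<partial>q (x, a))"
      using Suc.IH by (intro nn_integral_mono) simp
    then show ?thesis using finite_horizon_value_step[OF a, of n]
      by (meson add_left_mono order.trans)
  qed
  then show ?case by (subst (2) finite_horizon_value.simps) (rule INF_greatest)
qed simp

end

section \<open>Value iteration with compact action sets and semicontinuous data\<close>

locale semicontinuous_model =
  transition_model "restrict_space borel X" "restrict_space borel AA" A c q
  for X :: "'x::polish_space set" and AA :: "'a::polish_space set" and A c q +
  assumes compact_actions: "\<And>x. x \<in> X \<Longrightarrow> compact (A x)"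
    and actions: "\<And>x. x \<in> X \<Longrightarrow> A x \<noteq> {} \<and> A x \<subseteq> AA"
    and upper: "\<And>U. open U \<Longrightarrow> openin (top_of_set X) {x\<in>X. A x \<subseteq> U}"
    and cost_lsc: "lsc_on (Sigma X A) (\<lambda>z. ennreal (c z))"
    and weak: "\<And>f :: 'x \<Rightarrow> real. continuous_on X f \<Longrightarrow> bounded (f ` X) \<Longrightarrow>
      continuous_on (Sigma X A) (\<lambda>z. \<integral>y. f y \<partial>q z)"
begin

lemma space_state[simp]: "space (restrict_space borel X) = X"
  by (simp add: space_restrict_space)

lemma action_value_lsc:
  assumes "lsc_on X u" shows "lsc_on (Sigma X A) (\<lambda>z. ennreal (c z) + (\<integral>\<^sup>+y. u y \<partial>q z))"
  using assms finite_kernel sets_kernel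
  by (intro lsc_on_add cost_lsc lsc_on_nn_integral[where X=X] weak) simp_all

lemma finite_horizon_value_lsc: "lsc_on X (finite_horizon_value n)"
proof (induction n)
  case 0
  show ?case by (simp add: lsc_on_continuous)
next
  case (Suc n)
  show ?case unfolding finite_horizon_value.simps
    using actions by (intro lsc_on_INF_fibre[OF action_value_lsc[OF Suc] compact_actions _ upper]) auto
qed

lemma finite_horizon_value_measurable: "finite_horizon_value n \<in> borel_measurable (restrict_space borel X)"
  by (rule lsc_on_measurable[OF finite_horizon_value_lsc])

lemma infinite_horizon_value_lsc: "lsc_on X infinite_horizon_value"
  unfolding infinite_horizon_value_def[abs_def] by (rule lsc_on_SUP) (rule finite_horizon_value_lsc)

lemma action_value_SUP:
  assumes x: "x \<in> X" "a \<in> A x"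
  shows "ennreal (c (x, a)) + (\<integral>\<^sup>+y. infinite_horizon_value y \<partial>q (x, a)) =
    (SUP n. ennreal (c (x, a)) + (\<integral>\<^sup>+y. finite_horizon_value n y \<partial>q (x, a)))"
proof -
  have z: "(x, a) \<in> graph" using x by simp
  have sp: "space (q (x, a)) = X" using space_kernel[OF z] by simp
  have "(\<integral>\<^sup>+y. infinite_horizon_value y \<partial>q (x, a)) = (SUP n. \<integral>\<^sup>+y. finite_horizon_value n y \<partial>q (x, a))"
    unfolding infinite_horizon_value_def
    using finite_horizon_value_mono finite_horizon_value_measurable
    by (intro nn_integral_monotone_convergence_SUP_AE)
      (auto simp: sp measurable_cong_sets[OF sets_kernel[OF z] refl] simp del: finite_horizon_value.simps intro!: AE_I2)
  then show ?thesis by (simp add: ennreal_SUP_add_right)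
qed

lemma infinite_horizon_value_le:
  assumes x: "x \<in> X" "a \<in> A x"
  shows "infinite_horizon_value x \<le> ennreal (c (x, a)) + (\<integral>\<^sup>+y. infinite_horizon_value y \<partial>q (x, a))"
  unfolding action_value_SUP[OF x] infinite_horizon_value_def[of x]
proof (rule SUP_mono, intro bexI)
  fix n
  show "finite_horizon_value n x \<le> ennreal (c (x, a)) + (\<integral>\<^sup>+y. finite_horizon_value n y \<partial>q (x, a))"
    using finite_horizon_value_mono[of x n] finite_horizon_value_step[OF x(2), of n] x
    by (metis order.trans space_state)
qed simp

lemma infinite_horizon_value_attained:
  assumes x: "x \<in> X"
  shows "\<exists>a\<in>A x. ennreal (c (x, a)) + (\<integral>\<^sup>+y. infinite_horizon_value y \<partial>q (x, a)) \<le> infinite_horizon_value x"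
proof -
  define g where "g n a = ennreal (c (x, a)) + (\<integral>\<^sup>+y. finite_horizon_value n y \<partial>q (x, a))" for n a
  have "\<exists>a\<in>A x. (SUP n. g n a) \<le> (SUP n. INF b\<in>A x. g n b)"
  proof (rule lsc_on_attains_limit_of_minima)
    show "compact (A x)" "A x \<noteq> {}" using compact_actions actions x by auto
    show "lsc_on (A x) (g n)" for n
      unfolding g_def[abs_def] by (rule lsc_on_section[OF action_value_lsc[OF finite_horizon_value_lsc] x])
    show "g n a \<le> g (Suc n) a" if "a \<in> A x" for n a
      unfolding g_def using space_kernel[of "(x, a)"] that x finite_horizon_value_mono
      by (intro add_left_mono nn_integral_mono) (simp del: finite_horizon_value.simps)
  qed
  then obtain a where a: "a \<in> A x" "(SUP n. g n a) \<le> (SUP n. INF b\<in>A x. g n b)" by blast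
  \<comment> \<open>Minimizing with \<open>n\<close> stages to go afterwards gives horizon
    \<open>Suc n\<close>; the shift is harmless under the supremum.\<close>
  have "(INF b\<in>A x. g n b) = finite_horizon_value (Suc n) x" for n
    by (simp add: g_def)
  then have "(SUP n. INF b\<in>A x. g n b) \<le> infinite_horizon_value x"
    unfolding infinite_horizon_value_def by (auto intro!: SUP_least SUP_upper simp del: finite_horizon_value.simps)
  then have "(SUP n. g n a) \<le> infinite_horizon_value x" using a(2) by (rule order.trans[rotated])
  then show ?thesis
    using a(1) unfolding g_def action_value_SUP[OF x a(1), symmetric] by blast
qed

lemma optimal_selector:
  "\<exists>\<phi>\<in>selectors (restrict_space borel X) (restrict_space borel AA) A. \<forall>x\<in>X.
    infinite_horizon_value x = ennreal (c (x, \<phi> x)) + (\<integral>\<^sup>+y. infinite_horizon_value y \<partial>q (x, \<phi> x))"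
proof -
  obtain \<phi> where \<phi>: "\<phi> \<in> borel_measurable (restrict_space borel X)"
    "\<And>x. x \<in> X \<Longrightarrow> \<phi> x \<in> A x"
    "\<And>x b. x \<in> X \<Longrightarrow> b \<in> A x \<Longrightarrow>
      ennreal (c (x, \<phi> x)) + (\<integral>\<^sup>+y. infinite_horizon_value y \<partial>q (x, \<phi> x)) \<le>
      ennreal (c (x, b)) + (\<integral>\<^sup>+y. infinite_horizon_value y \<partial>q (x, b))"
    using measurable_minimizer[OF action_value_lsc[OF infinite_horizon_value_lsc] compact_actions _ upper] actions
    by metis
  have "\<phi> \<in> selectors (restrict_space borel X) (restrict_space borel AA) A"
    using \<phi>(1,2) actions by (simp add: selectors_def) (intro measurable_restrict_space2, auto)
  \<comment> \<open>The minimal action value is at least the limit value by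
    \<open>infinite_horizon_value_le\<close> and at most that value because some action attains it;
    a minimizer therefore yields equality.\<close>
  moreover have "infinite_horizon_value x = ennreal (c (x, \<phi> x)) + (\<integral>\<^sup>+y. infinite_horizon_value y \<partial>q (x, \<phi> x))"
    if x: "x \<in> X" for x
    using infinite_horizon_value_le[OF x \<phi>(2)[OF x]] infinite_horizon_value_attained[OF x] \<phi>(3)[OF x]
    by (meson antisym order.trans)
  ultimately show ?thesis by blast
qed

end

text \<open>Measurability of \<open>v\<close> belongs to the conclusion because only then do the
  integrals of \<open>v\<close> have their usual meaning. The comparison with the transformed
  process is asserted for every admissible pair of \<mu> and \<beta>.\<close>

theorem corollary3:
  fixes X :: "'x::polish_space set" and AA :: "'a::polish_space set"
    and A :: "'x \<Rightarrow> 'a set"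
    and c :: "'x \<times> 'a \<Rightarrow> real"
    and q :: "'x \<times> 'a \<Rightarrow> 'x measure"
    and p0 :: "'x measure"
    and V :: "'x \<Rightarrow> real" and K :: real
    and MX :: "'x measure" and MA :: "'a measure"
    and v :: "'x \<Rightarrow> ennreal"
  assumes X: "X \<in> sets borel" and AA: "AA \<in> sets borel"
    and MX: "MX = restrict_space borel X" and MA: "MA = restrict_space borel AA"
    and A: "\<And>x. x \<in> X \<Longrightarrow> A x \<noteq> {} \<and> A x \<subseteq> AA \<and> A x \<in> sets borel"
    and Gr: "Sigma X A \<in> sets borel"
    and selector: "\<exists>\<phi>. \<phi> \<in> selectors MX MA A"
    and c_nonneg: "\<And>z. z \<in> Sigma X A \<Longrightarrow> 0 \<le> c z"
    and c_borel: "c \<in> borel_measurable (restrict_space borel (Sigma X A))"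
    and q_sets: "\<And>z. z \<in> Sigma X A \<Longrightarrow> sets (q z) = sets MX"
    and q_finite: "\<And>z. z \<in> Sigma X A \<Longrightarrow> finite_measure (q z)"
    and q_borel: "\<And>B. B \<in> sets MX \<Longrightarrow>
          (\<lambda>z. emeasure (q z) B) \<in> borel_measurable (restrict_space borel (Sigma X A))"
    and q_bounded: "(SUP z\<in>Sigma X A. emeasure (q z) X) < \<infinity>"
    and p0: "prob_space p0" "sets p0 = sets MX"
    and v: "v = total_value MX MA A c q p0"
    and T_V: "continuous_on X V" "\<And>x. x \<in> X \<Longrightarrow> 1 \<le> V x"
    and T_bound: "\<And>\<phi> x. \<phi> \<in> selectors MX MA A \<Longrightarrow> x \<in> X \<Longrightarrow>
          (\<Sum>n. (kernel_op q \<phi> ^^ n) (\<lambda>y. ennreal (V y)) x) \<le> ennreal (K * V x)"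
    and W_i: "\<And>x. x \<in> X \<Longrightarrow> compact (A x)" "continuous_set_valued X AA A"
    and W_ii: "\<And>f :: 'x \<Rightarrow> real. continuous_on X f \<Longrightarrow> bounded (f ` X) \<Longrightarrow>
          continuous_on (Sigma X A) (\<lambda>z. \<integral>y. f y \<partial>q z)"
    and W_iii: "lower_semicontinuous_on (Sigma X A) c"
    and V_integral: "continuous_on (Sigma X A) (\<lambda>z. \<integral>\<^sup>+ y. ennreal (V y) \<partial>q z)"
  shows
    "(v \<in> borel_measurable MX \<and>
      (\<forall>x\<in>X. (\<exists>a\<in>A x. v x = ennreal (c (x, a)) + (\<integral>\<^sup>+ y. v y \<partial>q (x, a))) \<and>
              (\<forall>a\<in>A x. v x \<le> ennreal (c (x, a)) + (\<integral>\<^sup>+ y. v y \<partial>q (x, a))))) \<and>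
     (\<exists>\<phi>\<in>selectors MX MA A. total_cost_optimal MX MA A c q p0 (stationary MA \<phi>)) \<and>
     (\<forall>\<phi>\<in>selectors MX MA A.
        (total_cost_optimal MX MA A c q p0 (stationary MA \<phi>) \<longleftrightarrow>
          (\<forall>x\<in>X. v x = ennreal (c (x, \<phi> x)) + (\<integral>\<^sup>+ y. v y \<partial>q (x, \<phi> x)))) \<and>
        (\<forall>\<mu> \<beta>.
          continuous_on X \<mu> \<and>
          (\<forall>x\<in>X. 1 \<le> \<mu> x \<and> V x \<le> \<mu> x \<and> \<mu> x \<le> K * V x) \<and>
          (\<forall>x\<in>X. \<forall>a\<in>A x. ennreal (V x) + (\<integral>\<^sup>+ y. ennreal (\<mu> y) \<partial>q (x, a)) \<le> ennreal (\<mu> x)) \<and>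
          (K - 1) / K \<le> \<beta> \<and> 0 < \<beta> \<and> \<beta> < 1 \<longrightarrow>
          ((\<forall>x\<in>X. v x = ennreal (c (x, \<phi> x)) + (\<integral>\<^sup>+ y. v y \<partial>q (x, \<phi> x))) \<longleftrightarrow>
            hv_optimal MX MA A c q \<mu> \<beta> \<phi>)))"
proof -
  have sX: "space MX = X" and sA: "space MA = AA" by (simp_all add: MX MA space_restrict_space)
  \<comment> \<open>The hypotheses on the graph refer to the Borel algebra of the ambient product,
    the decision model to the product of the restricted algebras; the identity map carries
    measurability from one to the other.\<close>
  have id: "(\<lambda>z. z) \<in> MX \<Otimes>\<^sub>M MA \<rightarrow>\<^sub>M borel"
    unfolding MX MA by (rule measurable_pair_restrict_borel)
  have graph_sets: "Sigma X A \<in> sets (MX \<Otimes>\<^sub>M MA)"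
  proof -
    have "(\<lambda>z. z) -` Sigma X A \<inter> space (MX \<Otimes>\<^sub>M MA) = Sigma X A"
      using A by (auto simp: space_pair_measure sX sA)
    then show ?thesis using measurable_sets[OF id Gr] by simp
  qed
  have on_graph: "f \<in> borel_measurable (restrict_space (MX \<Otimes>\<^sub>M MA) (Sigma X A))"
    if "f \<in> borel_measurable (restrict_space borel (Sigma X A))" for f :: "_ \<Rightarrow> 'r::topological_space"
    by (rule measurable_compose[OF measurable_restrict_space3[OF id] that]) simp
  interpret semicontinuous_model X AA A c q
    unfolding semicontinuous_model_def transition_model_def semicontinuous_model_axioms_def MX[symmetric] MA[symmetric] sX
    using graph_sets c_nonneg on_graph[OF c_borel] q_sets q_finite on_graph[OF q_borel] W_i(1) A
      continuous_set_valued_upper[OF W_i(2)] lower_semicontinuous_on_lsc[OF W_iii] W_ii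
    by auto
  note [simp del] = finite_horizon_value.simps
  define J where "J \<phi> = total_cost MX MA A c q p0 (stationary MA \<phi>)" for \<phi>
  have policy: "stationary MA \<phi> \<in> policies MX MA A" if "\<phi> \<in> selectors MX MA A" for \<phi>
    using stationary_policy[OF that] graph_sets by (simp add: sX)
  have J_fix: "J \<phi> x = ennreal (c (x, \<phi> x)) + (\<integral>\<^sup>+y. J \<phi> y \<partial>q (x, \<phi> x))"
    if "\<phi> \<in> selectors MX MA A" "x \<in> X" for \<phi> x
    using stationary_cost_fixpoint[folded MX MA, OF p0 that(1)] that(2) unfolding J_def by (simp add: sX)
  have J_le: "J \<phi> x \<le> w x" if "\<phi> \<in> selectors MX MA A" "x \<in> X"
    "\<And>x. x \<in> X \<Longrightarrow> ennreal (c (x, \<phi> x)) + (\<integral>\<^sup>+y. w y \<partial>q (x, \<phi> x)) \<le> w x" for \<phi> x w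
    using stationary_cost_upper_bound[folded MX MA, OF p0 that(1), of x w] that(2,3) unfolding J_def by (simp add: sX)
  have v_le: "v x \<le> J \<phi> x" if "\<phi> \<in> selectors MX MA A" for \<phi> x
    unfolding v total_value_def J_def by (rule INF_lower[OF policy[OF that]])
  obtain \<psi> where \<psi>: "\<psi> \<in> selectors MX MA A" and
    \<psi>_opt: "\<And>x. x \<in> X \<Longrightarrow> infinite_horizon_value x =
      ennreal (c (x, \<psi> x)) + (\<integral>\<^sup>+y. infinite_horizon_value y \<partial>q (x, \<psi> x))"
    using optimal_selector[folded MX MA] by blast
  have value_le: "infinite_horizon_value x \<le> v x" if x: "x \<in> X" for x
    unfolding v total_value_def infinite_horizon_value_def
  proof (intro INF_greatest SUP_least)
    fix \<pi> n assume "\<pi> \<in> policies MX MA A"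
    then show "finite_horizon_value n x \<le> total_cost MX MA A c q p0 \<pi> x"
      using x finite_horizon_value_measurable
      by (intro total_cost_lower_bound[folded MX MA, OF p0])
        (auto simp: sX MX intro: finite_horizon_value_step simp: finite_horizon_value.simps(1))
  qed
  have J\<psi>_le: "J \<psi> x \<le> infinite_horizon_value x" if "x \<in> X" for x
    by (rule J_le[OF \<psi> that]) (simp add: \<psi>_opt[symmetric])
  \<comment> \<open>On \<open>X\<close> the three functions close a cycle: limit value, then
    \<open>v\<close>, then the cost of \<psi>, then the limit value again.\<close>
  have v_eq: "v x = infinite_horizon_value x" and J\<psi>: "J \<psi> x = v x" if "x \<in> X" for x
    using v_le[OF \<psi>, of x] J\<psi>_le[OF that] value_le[OF that] by auto
  have int_cong: "(\<integral>\<^sup>+y. f y \<partial>q (x, a)) = (\<integral>\<^sup>+y. g y \<partial>q (x, a))"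
    if "x \<in> X" "a \<in> A x" "\<And>y. y \<in> X \<Longrightarrow> f y = g y" for x a and f g :: "'x \<Rightarrow> ennreal"
    using space_kernel[of "(x, a)"] that by (intro nn_integral_cong) simp
  have sel: "\<phi> x \<in> A x" if "\<phi> \<in> selectors MX MA A" "x \<in> X" for \<phi> x
    using that by (simp add: selectors_def sX)
  have optimal_iff: "total_cost_optimal MX MA A c q p0 (stationary MA \<phi>) \<longleftrightarrow> (\<forall>x\<in>X. J \<phi> x = v x)" for \<phi>
    by (simp add: total_cost_optimal_def J_def v sX)
  have equation_iff: "(\<forall>x\<in>X. J \<phi> x = v x) \<longleftrightarrow>
      (\<forall>x\<in>X. v x = ennreal (c (x, \<phi> x)) + (\<integral>\<^sup>+y. v y \<partial>q (x, \<phi> x)))"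
    if \<phi>: "\<phi> \<in> selectors MX MA A" for \<phi>
  proof
    assume eq: "\<forall>x\<in>X. J \<phi> x = v x"
    show "\<forall>x\<in>X. v x = ennreal (c (x, \<phi> x)) + (\<integral>\<^sup>+y. v y \<partial>q (x, \<phi> x))"
    proof
      fix x assume x: "x \<in> X"
      have "(\<integral>\<^sup>+y. J \<phi> y \<partial>q (x, \<phi> x)) = (\<integral>\<^sup>+y. v y \<partial>q (x, \<phi> x))"
        by (rule int_cong) (use x eq sel[OF \<phi>] in auto)
      then show "v x = ennreal (c (x, \<phi> x)) + (\<integral>\<^sup>+y. v y \<partial>q (x, \<phi> x))"
        using J_fix[OF \<phi> x] eq x by simp
    qed
  next
    assume eq: "\<forall>x\<in>X. v x = ennreal (c (x, \<phi> x)) + (\<integral>\<^sup>+y. v y \<partial>q (x, \<phi> x))"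
    \<comment> \<open>The equation makes \<open>v\<close> a supersolution for \<phi>, and the cost
      of \<phi> lies below every supersolution.\<close>
    have "J \<phi> x \<le> v x" if "x \<in> X" for x
    proof (rule J_le[OF \<phi> that])
      show "ennreal (c (y, \<phi> y)) + (\<integral>\<^sup>+z. v z \<partial>q (y, \<phi> y)) \<le> v y" if "y \<in> X" for y
        by (rule eq_refl) (use eq that in metis)
    qed
    then show "\<forall>x\<in>X. J \<phi> x = v x" using v_le[OF \<phi>] by (auto intro: antisym)
  qed
  have part1: "v \<in> borel_measurable MX \<and>
      (\<forall>x\<in>X. (\<exists>a\<in>A x. v x = ennreal (c (x, a)) + (\<integral>\<^sup>+ y. v y \<partial>q (x, a))) \<and>
              (\<forall>a\<in>A x. v x \<le> ennreal (c (x, a)) + (\<integral>\<^sup>+ y. v y \<partial>q (x, a))))"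
  proof (intro conjI ballI)
    have "infinite_horizon_value \<in> borel_measurable MX"
      unfolding MX by (rule lsc_on_measurable[OF infinite_horizon_value_lsc])
    then show "v \<in> borel_measurable MX"
      by (subst measurable_cong[where g=infinite_horizon_value]) (simp_all add: v_eq sX)
    fix x assume x: "x \<in> X"
    show "\<exists>a\<in>A x. v x = ennreal (c (x, a)) + (\<integral>\<^sup>+ y. v y \<partial>q (x, a))"
      using equation_iff[OF \<psi>] J\<psi> sel[OF \<psi> x] x by blast
    fix a assume a: "a \<in> A x"
    show "v x \<le> ennreal (c (x, a)) + (\<integral>\<^sup>+ y. v y \<partial>q (x, a))"
      using infinite_horizon_value_le[OF x a] int_cong[OF x a v_eq] v_eq[OF x] by simp
  qed
  have part2: "\<exists>\<phi>\<in>selectors MX MA A. total_cost_optimal MX MA A c q p0 (stationary MA \<phi>)"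
    using \<psi> J\<psi> optimal_iff by blast
  have hv: "(\<forall>x\<in>X. J \<phi> x = v x) \<longleftrightarrow> hv_optimal MX MA A c q \<mu> \<beta> \<phi>"
    if \<phi>: "\<phi> \<in> selectors MX MA A" and \<mu>_cont: "continuous_on X \<mu>"
      and \<mu>: "\<And>x. x \<in> X \<Longrightarrow> 1 \<le> \<mu> x \<and> V x \<le> \<mu> x \<and> \<mu> x \<le> K * V x"
      and drift: "\<And>x a. x \<in> X \<Longrightarrow> a \<in> A x \<Longrightarrow> ennreal (V x) + (\<integral>\<^sup>+ y. ennreal (\<mu> y) \<partial>q (x, a)) \<le> ennreal (\<mu> x)"
      and \<beta>: "(K - 1) / K \<le> \<beta>" "0 < \<beta>" "\<beta> < 1" for \<phi> \<mu> \<beta>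
  proof -
    \<comment> \<open>This is the origin of the bound on \<beta>: the integral is at most \<mu> - V,
      and \<mu> \<le> K V turns this into at most (1 - 1/K) \<mu>.\<close>
    have contraction: "(\<integral>\<^sup>+ y. ennreal (\<mu> y) \<partial>q (x, a)) \<le> ennreal (\<beta> * \<mu> x)" if x: "x \<in> X" "a \<in> A x" for x a
    proof -
      let ?I = "\<integral>\<^sup>+ y. ennreal (\<mu> y) \<partial>q (x, a)"
      \<comment> \<open>Finiteness comes first, so that the drift inequality can be rearranged among
        real numbers.\<close>
      have "?I \<le> ennreal (\<mu> x)" using drift[OF x] by (meson add_increasing order.trans order_refl zero_le)
      then have "?I < top" by (rule le_less_trans) simp
      then obtain r where r: "?I = ennreal r" "0 \<le> r" by (cases ?I) auto
      have V: "1 \<le> V x" "\<mu> x \<le> K * V x" "1 \<le> \<mu> x" using T_V(2) \<mu> x by auto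
      have "V x + r \<le> \<mu> x" using drift[OF x] V r by (simp add: ennreal_plus[symmetric] del: ennreal_plus)
      have "0 < K" using V by (smt (verit) mult_nonpos_nonneg)
      have "\<mu> x / K \<le> V x" using V(2) \<open>0 < K\<close> by (simp add: field_simps)
      then have "r \<le> \<mu> x - \<mu> x / K" using \<open>V x + r \<le> \<mu> x\<close> by simp
      also have "\<dots> = (K - 1) / K * \<mu> x" using \<open>0 < K\<close> by (simp add: field_simps)
      also have "\<dots> \<le> \<beta> * \<mu> x" using \<beta>(1) V(3) by (intro mult_right_mono) auto
      finally show ?thesis unfolding r(1) by (rule ennreal_leI)
    qed
    \<comment> \<open>A probability measure \<open>p0\<close> on \<open>X\<close> exists, so there
      is a state and hence the feasible pair required by \<open>hv_model\<close>.\<close>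
    have "X \<noteq> {}" using prob_space.not_empty[OF p0(1)] sets_eq_imp_space_eq[OF p0(2)] by (simp add: sX)
    then have "Sigma X A \<noteq> {}" using A by auto
    have \<mu>_meas: "\<mu> \<in> borel_measurable MX"
      unfolding MX by (rule borel_measurable_continuous_on_restrict[OF \<mu>_cont])
    interpret hv: hv_model MX MA A c q \<mu> \<beta>
      using transition_model_axioms[folded MX MA]
    proof (rule hv_model.intro)
      show "hv_model_axioms MX A q \<mu> \<beta>"
        using \<mu>_meas \<mu> \<beta>(2) contraction \<open>Sigma X A \<noteq> {}\<close>
        by unfold_locales (fastforce simp: sX)+
    qed
    note [simp del] = hv.finite_horizon_value.simps
    let ?d = "discounted_cost (adjoin_point MX) (adjoin_point MA) (hv_cost \<mu> c) (hv_kernel MX A q \<mu> \<beta>) \<beta>"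
    let ?st = "\<lambda>\<phi>. stationary (adjoin_point MA) (map_option \<phi>)"
    have d_stationary: "?d (?st \<phi>) s = case_option 0 (\<lambda>x. J \<phi> x / ennreal (\<mu> x)) s"
      if "\<phi> \<in> selectors MX MA A" "s \<in> space (adjoin_point MX)" for \<phi> s
      using hv.discounted_cost_stationary[OF that] that(2)
      by (auto simp: J_def hv.total_cost_stationary[OF p0 that(1)] simp del: space_adjoin_point split: option.split)
        (auto simp: hv.total_cost_stationary[OF p0 that(1)])
    \<comment> \<open>The transformed value is \<open>v / \<mu>\<close>: the policy of \<psi>
      attains it, and the finite-horizon values divided by \<mu> bound every policy of the new
      process from below.\<close>
    have inf: "(INF \<pi>\<in>policies (adjoin_point MX) (adjoin_point MA) (hv_actions A). ?d \<pi> s) =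
        case_option 0 (\<lambda>x. v x / ennreal (\<mu> x)) s" if s: "s \<in> space (adjoin_point MX)" for s
    proof (rule antisym)
      have "?st \<psi> \<in> policies (adjoin_point MX) (adjoin_point MA) (hv_actions A)"
        by (rule stationary_policy[OF hv.map_option_selector[OF \<psi>] hv.hgraph_sets])
      then have "(INF \<pi>\<in>policies (adjoin_point MX) (adjoin_point MA) (hv_actions A). ?d \<pi> s) \<le> ?d (?st \<psi>) s"
        by (rule INF_lower)
      also have "\<dots> = case_option 0 (\<lambda>x. v x / ennreal (\<mu> x)) s"
        using d_stationary[OF \<psi> s] s J\<psi> by (auto simp: sX)
      finally show "(INF \<pi>\<in>policies (adjoin_point MX) (adjoin_point MA) (hv_actions A). ?d \<pi> s) \<le>
        case_option 0 (\<lambda>x. v x / ennreal (\<mu> x)) s" .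
      show "case_option 0 (\<lambda>x. v x / ennreal (\<mu> x)) s \<le>
        (INF \<pi>\<in>policies (adjoin_point MX) (adjoin_point MA) (hv_actions A). ?d \<pi> s)"
      proof (rule INF_greatest)
        fix \<pi> assume \<pi>: "\<pi> \<in> policies (adjoin_point MX) (adjoin_point MA) (hv_actions A)"
        have lower: "case_option 0 (\<lambda>x. finite_horizon_value n x / ennreal (\<mu> x)) s \<le> ?d \<pi> s" for n
          using finite_horizon_value_measurable
          by (intro hv.discounted_cost_lower_bound[OF \<pi> s])
            (auto simp: MX intro: finite_horizon_value_step simp: finite_horizon_value.simps(1))
        show "case_option 0 (\<lambda>x. v x / ennreal (\<mu> x)) s \<le> ?d \<pi> s"
        proof (cases s)
          case (Some x)
          then have "x \<in> X" using s by (auto simp: sX)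
          then have "v x / ennreal (\<mu> x) = (SUP n. finite_horizon_value n x / ennreal (\<mu> x))"
            by (simp add: v_eq infinite_horizon_value_def SUP_divide_ennreal)
          then show ?thesis using lower Some by (auto intro: SUP_least)
        qed simp
      qed
    qed
    have "hv_optimal MX MA A c q \<mu> \<beta> \<phi> \<longleftrightarrow> (\<forall>s\<in>space (adjoin_point MX).
        case_option 0 (\<lambda>x. J \<phi> x / ennreal (\<mu> x)) s = case_option 0 (\<lambda>x. v x / ennreal (\<mu> x)) s)"
      unfolding hv_optimal_def discount_optimal_def
      by (intro ball_cong refl) (simp only: d_stationary[OF \<phi>] inf)
    also have "\<dots> \<longleftrightarrow> (\<forall>x\<in>X. J \<phi> x / ennreal (\<mu> x) = v x / ennreal (\<mu> x))"
      by (simp add: sX)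
    also have "\<dots> \<longleftrightarrow> (\<forall>x\<in>X. J \<phi> x = v x)"
    proof (intro ball_cong refl iffI)
      fix x assume x: "x \<in> X" and eq: "J \<phi> x / ennreal (\<mu> x) = v x / ennreal (\<mu> x)"
      \<comment> \<open>Since \<open>\<mu> x\<close> is positive and finite, multiplication by it
        recovers \<open>J \<phi> x\<close> and \<open>v x\<close>, even if they are
        infinite.\<close>
      have "0 < \<mu> x" using \<mu>[OF x] by linarith
      then show "J \<phi> x = v x"
        using arg_cong[OF eq, of "\<lambda>t. ennreal (\<mu> x) * t"] by (simp only: ennreal_mult_divide_cancel)
    qed simp
    finally show ?thesis by blast
  qed
  have part3: "(total_cost_optimal MX MA A c q p0 (stationary MA \<phi>) \<longleftrightarrow>
          (\<forall>x\<in>X. v x = ennreal (c (x, \<phi> x)) + (\<integral>\<^sup>+ y. v y \<partial>q (x, \<phi> x)))) \<and>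
        (\<forall>\<mu> \<beta>.
          continuous_on X \<mu> \<and>
          (\<forall>x\<in>X. 1 \<le> \<mu> x \<and> V x \<le> \<mu> x \<and> \<mu> x \<le> K * V x) \<and>
          (\<forall>x\<in>X. \<forall>a\<in>A x. ennreal (V x) + (\<integral>\<^sup>+ y. ennreal (\<mu> y) \<partial>q (x, a)) \<le> ennreal (\<mu> x)) \<and>
          (K - 1) / K \<le> \<beta> \<and> 0 < \<beta> \<and> \<beta> < 1 \<longrightarrow>
          ((\<forall>x\<in>X. v x = ennreal (c (x, \<phi> x)) + (\<integral>\<^sup>+ y. v y \<partial>q (x, \<phi> x))) \<longleftrightarrow>
            hv_optimal MX MA A c q \<mu> \<beta> \<phi>))" if \<phi>: "\<phi> \<in> selectors MX MA A" for \<phi>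
    unfolding optimal_iff equation_iff[OF \<phi>, symmetric]
  proof (intro conjI allI impI refl)
    fix \<mu> \<beta>
    assume "continuous_on X \<mu> \<and>
          (\<forall>x\<in>X. 1 \<le> \<mu> x \<and> V x \<le> \<mu> x \<and> \<mu> x \<le> K * V x) \<and>
          (\<forall>x\<in>X. \<forall>a\<in>A x. ennreal (V x) + (\<integral>\<^sup>+ y. ennreal (\<mu> y) \<partial>q (x, a)) \<le> ennreal (\<mu> x)) \<and>
          (K - 1) / K \<le> \<beta> \<and> 0 < \<beta> \<and> \<beta> < 1"
    then show "(\<forall>x\<in>X. J \<phi> x = v x) \<longleftrightarrow> hv_optimal MX MA A c q \<mu> \<beta> \<phi>"
      by (intro hv[OF \<phi>]) auto
  qed
  show ?thesis by (rule conjI[OF part1 conjI[OF part2 ballI[OF part3]]])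
qed

end
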